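(* Let $\mathbf{x}$ and $\mathbf{x}_0$ be points of $\mathbb{R}^3$ with $\mathbf{x}\neq\mathbf{x}_0$, having parabolic cylinder coordinates $(\xi,\eta,z)$ and $(\xi_0,\eta_0,z_0)$, respectively. Put $\eta_<=\min\{\eta,\eta_0\}$ and $\eta_>=\max\{\eta,\eta_0\}$. Then $$\frac{1}{\|\mathbf{x}-\mathbf{x}_0\|}=\frac{2}{\sqrt{\pi}}\int_0^\infty e^{-\frac{k}{2}(\xi^2+\eta_>^2+\xi_0^2-\eta_<^2)}\cos\bigl(k(z-z_0)\bigr)\sum_{n=0}^\infty\frac{(-i)^n}{2^{n-1}n!}H_n(\sqrt{k}\,\xi)\,H_{-n-1}(\sqrt{k}\,\eta_>)\,H_n(\sqrt{k}\,\xi_0)\,H_n(i\sqrt{k}\,\eta_<)\,dk.$$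
   Context: $\|\cdot\|$ is the Euclidean norm on $\mathbb{R}^3$. Parabolic cylinder coordinates $(\xi,\eta,z)$ with $\xi\in\mathbb{R}$, $\eta\in[0,\infty)$, $z\in\mathbb{R}$ are related to Cartesian coordinates by $x=\frac12(\xi^2-\eta^2)$, $y=\xi\eta$, $z=z$. Kummer's function is $M(a,b,z)=\sum_{n=0}^\infty \frac{(a)_n z^n}{(b)_n n!}$, with $(a)_n$ the Pochhammer symbol. For $\nu,z\in\mathbb{C}$ the Hermite function is $$H_\nu(z)=\frac{2^\nu\sqrt{\pi}}{\Gamma\left(\frac{1-\nu}{2}\right)}M\left(-\frac{\nu}{2},\frac12,z^2\right)-\frac{2^{\nu+1}\sqrt{\pi}}{\Gamma\left(-\frac{\nu}{2}\right)}\,z\,M\left(\frac{1-\nu}{2},\frac32,z^2\right),$$ with $1/\Gamma$ understood as an entire function. For $\nu=n\in\{0,1,2,\dots\}$ it is the (physicists') Hermite polynomial of degree $n$.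
   Formalization: The points are assumed to differ in their (x,y)-projections, not merely to be distinct: if they lie on one line parallel to the z-axis, the series over n diverges for every k > 0 (e.g. ξ=ξ₀=η=η₀=0, where the even-n terms behave like c/n), so the right-hand side is undefined. *)

theory Defs
  imports "HOL-Analysis.Analysis"
begin

definition kummer_M :: "complex \<Rightarrow> complex \<Rightarrow> complex \<Rightarrow> complex" where
  "kummer_M a b z = (\<Sum>n. pochhammer a n * z ^ n / (pochhammer b n * fact n))"

text \<open>The reciprocal Gamma function is the entire function \<open>rGamma\<close>, so that the definition
  makes sense for every order, including the nonnegative integers.\<close>

definition hermite_H :: "complex \<Rightarrow> complex \<Rightarrow> complex" where
  "hermite_H \<nu> z =
     2 powr \<nu> * of_real (sqrt pi) * rGamma ((1 - \<nu>) / 2) * kummer_M (- \<nu> / 2) (1 / 2) (z\<^sup>2)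
   - 2 powr (\<nu> + 1) * of_real (sqrt pi) * rGamma (- \<nu> / 2) * z
       * kummer_M ((1 - \<nu>) / 2) (3 / 2) (z\<^sup>2)"

text \<open>A relation rather than a function of the point: the points with \<open>y = 0\<close> and \<open>x > 0\<close> have the two
  coordinate triples \<open>(\<xi>, 0, z)\<close> and \<open>(- \<xi>, 0, z)\<close>.\<close>

definition parabolic_cylinder_coords :: "real ^ 3 \<Rightarrow> real \<Rightarrow> real \<Rightarrow> real \<Rightarrow> bool" where
  "parabolic_cylinder_coords p \<xi> \<eta> z \<longleftrightarrow>
     \<eta> \<ge> 0 \<and> p $ 1 = (\<xi>\<^sup>2 - \<eta>\<^sup>2) / 2 \<and> p $ 2 = \<xi> * \<eta> \<and> p $ 3 = z"

text \<open>The general term of the expansion; \<open>a\<close> and \<open>b\<close> stand for the smaller and the larger of the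
  two \<open>\<eta>\<close>-coordinates. The exponent \<open>n - 1\<close> of 2 is an integer that equals \<open>- 1\<close> for \<open>n = 0\<close>.\<close>

definition expansion_term :: "real \<Rightarrow> real \<Rightarrow> real \<Rightarrow> real \<Rightarrow> real \<Rightarrow> nat \<Rightarrow> complex" where
  "expansion_term \<xi> \<xi>\<^sub>0 a b k n =
     (- \<i>) ^ n / (2 powi (int n - 1) * fact n)
       * hermite_H (of_nat n) (of_real (sqrt k * \<xi>))
       * hermite_H (- of_nat n - 1) (of_real (sqrt k * b))
       * hermite_H (of_nat n) (of_real (sqrt k * \<xi>\<^sub>0))
       * hermite_H (of_nat n) (\<i> * of_real (sqrt k * a))"

definition expansion_integrand ::
  "real \<Rightarrow> real \<Rightarrow> real \<Rightarrow> real \<Rightarrow> real \<Rightarrow> real \<Rightarrow> real \<Rightarrow> complex" where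
  "expansion_integrand \<xi> \<xi>\<^sub>0 a b z z\<^sub>0 k =
     of_real (exp (- (k / 2) * (\<xi>\<^sup>2 + b\<^sup>2 + \<xi>\<^sub>0\<^sup>2 - a\<^sup>2)) * cos (k * (z - z\<^sub>0)))
       * (\<Sum>n. expansion_term \<xi> \<xi>\<^sub>0 a b k n)"

end

theory Submission
  imports Defs "HOL-Probability.Probability"
begin

text \<open>
  By the scaling \<open>\<xi> \<mapsto> sqrt k * \<xi>\<close> it suffices to sum the series for \<open>k = 1\<close>. The key is the product formula
  \<open>2 * sqrt pi * (- \<i>) ^ n * H\<^sub>n (\<i> * a) * H\<^sub>-\<^sub>n\<^sub>-\<^sub>1 (b)
    = \<integral> tanh u ^ n * exp (- (b * sinh u - a * cosh u)\<^sup>2) / cosh u du\<close> for \<open>0 \<le> a \<le> b\<close>,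
  obtained by comparing the generating functions in \<open>n\<close> of both sides. It turns the series into the
  integral over \<open>u\<close> of Mehler's generating function at \<open>tanh u\<close>, and the outcome is
  \<open>\<integral> exp (- k * (A * cosh u - B * sinh u)) du\<close> up to a factor, where
  \<open>A = (\<xi>\<^sup>2 + \<xi>\<^sub>0\<^sup>2 + \<eta>\<^sup>2 + \<eta>\<^sub>0\<^sup>2) / 2\<close>, \<open>B = \<xi> * \<xi>\<^sub>0 + \<eta> * \<eta>\<^sub>0\<close> and \<open>A\<^sup>2 - B\<^sup>2\<close> is the squared horizontal
  distance of the two points. Integrating first over \<open>k\<close> and then over \<open>u\<close>, with
  \<open>w = A * sinh u - B * cosh u\<close>, leaves the Lorentz integral \<open>\<integral> 1 / (w\<^sup>2 + \<parallel>p - p\<^sub>0\<parallel>\<^sup>2) dw\<close>.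
\<close>

subsection \<open>Kummer's function and the recurrence in the order\<close>

text \<open>The sum over \<open>n\<close> and the integral over \<open>u\<close> must be exchanged
  without absolute domination. For equal \<eta>-coordinates the weight decays only like
  \<open>1 / cosh u\<close> as \<open>u\<close> grows, and the normalised Hermite products are
  bounded only by a multiple of n^(-1/2). Since the sum of n^(-1/2) * (tanh u)^n grows like
  \<open>cosh u\<close>, a termwise estimate leaves a majorant that is not integrable. Hence the
  bounds on Hermite polynomials and on the partial sums of their products.

  The two generating functions of the product formula meet halfway. In the variable \<open>w\<close>
  the even part of the tanh side is a Gaussian times a Lorentz kernel. Writing that kernel as a
  Laplace integral of a cosine over t > 0 and integrating out \<open>w\<close> gives the integral
  obtained by summing the Hermite side. The change of variable covers the whole line only for
  \<open>\<bar>a\<bar> < b\<close>, so \<open>a = b\<close> is reached by continuity.\<close>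

lemma summable_kummer_M:
  assumes b: "Re b > 0"
  shows "summable (\<lambda>n. pochhammer a n * z ^ n / (pochhammer b n * fact n))"
proof -
  \<comment> \<open>The ratio of consecutive terms is at most \<open>C / Suc n\<close>, hence at
    most 1/2 once \<open>n \<ge> 2 * C\<close>.\<close>
  define C where "C = (norm a / Re b + 1) * norm z"
  have nz: "b + of_nat n \<noteq> 0" for n
    using b by (auto simp: complex_eq_iff)
  show ?thesis
  proof (rule summable_ratio_test[where c = "1 / 2" and N = "nat \<lceil>2 * C\<rceil>"])
    fix n :: nat
    assume n: "n \<ge> nat \<lceil>2 * C\<rceil>"
    define t where "t = pochhammer a n * z ^ n / (pochhammer b n * fact n)"
    have "pochhammer a (Suc n) * z ^ Suc n / (pochhammer b (Suc n) * fact (Suc n))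
        = t * ((a + of_nat n) / (b + of_nat n) * (z / of_nat (Suc n)))"
      by (simp add: pochhammer_Suc t_def field_simps del: of_nat_Suc)
    also have "norm \<dots> = norm t * (norm ((a + of_nat n) / (b + of_nat n)) * (norm z / Suc n))"
      by (simp add: norm_mult norm_divide del: of_nat_Suc)
    also have "\<dots> \<le> norm t * ((norm a / Re b + 1) * (norm z / Suc n))"
    proof (intro mult_left_mono mult_right_mono)
      have "Re b + n \<le> norm (b + of_nat n)"
        using complex_Re_le_cmod[of "b + of_nat n"] by simp
      then have "norm ((a + of_nat n) / (b + of_nat n)) \<le> (norm a + n) / (Re b + n)"
        unfolding norm_divide using b
        by (intro frac_le) (auto intro: norm_triangle_le)
      also have "\<dots> = norm a / (Re b + n) + n / (Re b + n)"
        by (simp add: add_divide_distrib)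
      also have "\<dots> \<le> norm a / Re b + 1"
        using b by (intro add_mono divide_left_mono) auto
      finally show "norm ((a + of_nat n) / (b + of_nat n)) \<le> norm a / Re b + 1" .
    qed auto
    also have "(norm a / Re b + 1) * (norm z / Suc n) = C / Suc n"
      by (simp add: C_def)
    also have "norm t * (C / Suc n) \<le> norm t * (1 / 2)"
    proof (intro mult_left_mono)
      have "2 * C \<le> Suc n"
        using n by linarith
      then show "C / Suc n \<le> 1 / 2"
        by (simp add: field_simps)
    qed simp
    finally show "norm (pochhammer a (Suc n) * z ^ Suc n / (pochhammer b (Suc n) * fact (Suc n)))
        \<le> 1 / 2 * norm (pochhammer a n * z ^ n / (pochhammer b n * fact n))"
      by (simp add: t_def)
  qed simp
qed

lemma kummer_M_sums:
  "Re b > 0 \<Longrightarrow>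
    (\<lambda>n. pochhammer a n * z ^ n / (pochhammer b n * fact n)) sums kummer_M a b z"
  unfolding kummer_M_def by (rule summable_sums[OF summable_kummer_M])

lemma pochhammer_nonzero_of_Re_pos:
  fixes b :: complex
  assumes "Re b > 0"
  shows "pochhammer b n \<noteq> 0"
  using assms by (subst pochhammer_eq_0_iff) (auto simp: complex_eq_iff)

text \<open>A comparison of coefficients once the factor \<open>z\<close> has shifted the index by
  one. This contiguous relation and the next one, both at \<open>b = 1 / 2\<close>, are what the
  recurrence of the Hermite functions needs.\<close>

lemma kummer_M_contiguous_a:
  assumes b: "Re b > 0"
  shows "kummer_M (a - 1) b z = kummer_M a b z - z / b * kummer_M a (b + 1) z"
proof -
  have nz: "pochhammer b n \<noteq> 0" "pochhammer (b + 1) n \<noteq> 0" "b + of_nat n \<noteq> 0" "b \<noteq> 0" for n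
    using b pochhammer_nonzero_of_Re_pos[of b n] pochhammer_nonzero_of_Re_pos[of "b + 1" n]
    by (auto simp: complex_eq_iff)
  let ?t = "\<lambda>a b n. pochhammer a n * z ^ n / (pochhammer b n * fact n)"
  define s where "s = (\<lambda>n. if n = 0 then 0 else z / b * ?t a (b + 1) (n - 1))"
  have "(\<lambda>n. z / b * ?t a (b + 1) n) sums (z / b * kummer_M a (b + 1) z)"
    using b by (intro sums_mult kummer_M_sums) auto
  then have "s sums (z / b * kummer_M a (b + 1) z)"
    using sums_Suc_iff[of s] by (simp add: s_def)
  then have "(\<lambda>n. ?t a b n - s n) sums (kummer_M a b z - z / b * kummer_M a (b + 1) z)"
    using b by (intro sums_diff kummer_M_sums)
  moreover have "?t a b n - s n = ?t (a - 1) b n" for n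
  proof (cases n)
    case (Suc m)
    have "pochhammer b (Suc m) = b * pochhammer (b + 1) m"
      "pochhammer (a - 1) (Suc m) = (a - 1) * pochhammer a m"
      "pochhammer a (Suc m) = (a + of_nat m) * pochhammer a m"
      using pochhammer_rec[of "a - 1" m] pochhammer_Suc[of a m]
      by (simp_all add: pochhammer_rec[of b] mult.commute)
    moreover have "of_nat (Suc m) \<noteq> (0 :: complex)"
      using of_nat_neq_0 by blast
    ultimately show ?thesis
      using nz
      by (simp add: Suc s_def divide_simps del: of_nat_Suc) (simp add: algebra_simps)
  qed (simp add: s_def)
  ultimately have "?t (a - 1) b sums (kummer_M a b z - z / b * kummer_M a (b + 1) z)"
    by simp
  with kummer_M_sums[OF b] show ?thesis
    by (rule sums_unique2)
qed

lemma kummer_M_contiguous_ab: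
  assumes b: "Re b > 0"
  shows "(a - b) * kummer_M a (b + 1) z = a * kummer_M (a + 1) (b + 1) z - b * kummer_M a b z"
proof -
  have nz: "pochhammer b n \<noteq> 0" "pochhammer (b + 1) n \<noteq> 0" "b + of_nat n \<noteq> 0" "b \<noteq> 0" for n
    using b pochhammer_nonzero_of_Re_pos[of b n] pochhammer_nonzero_of_Re_pos[of "b + 1" n]
    by (auto simp: complex_eq_iff)
  let ?t = "\<lambda>a b n. pochhammer a n * z ^ n / (pochhammer b n * fact n)"
  have "a * ?t (a + 1) (b + 1) n - b * ?t a b n = (a - b) * ?t a (b + 1) n" for n
  proof -
    have pa: "a * pochhammer (a + 1) n = (a + of_nat n) * pochhammer a n"
      using pochhammer_rec[of a n] pochhammer_Suc[of a n] by (simp add: mult.commute)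
    have "b * pochhammer (b + 1) n = (b + of_nat n) * pochhammer b n"
      using pochhammer_rec[of b n] pochhammer_Suc[of b n] by (simp add: mult.commute)
    then have pb: "b / pochhammer b n = (b + of_nat n) / pochhammer (b + 1) n"
      using nz by (simp add: divide_simps mult.commute)
    have "a * ?t (a + 1) (b + 1) n - b * ?t a b n
        = (a * pochhammer (a + 1) n) * z ^ n / (pochhammer (b + 1) n * fact n)
          - (b / pochhammer b n) * (pochhammer a n * z ^ n / fact n)"
      by simp
    also have "\<dots> = (a - b) * ?t a (b + 1) n"
      unfolding pa pb using nz by (simp add: divide_simps) (simp add: algebra_simps)
    finally show ?thesis .
  qed
  moreover have "(\<lambda>n. a * ?t (a + 1) (b + 1) n - b * ?t a b n)
      sums (a * kummer_M (a + 1) (b + 1) z - b * kummer_M a b z)"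
    using b by (intro sums_diff sums_mult kummer_M_sums) auto
  ultimately have "(\<lambda>n. (a - b) * ?t a (b + 1) n)
      sums (a * kummer_M (a + 1) (b + 1) z - b * kummer_M a b z)"
    by simp
  moreover have "(\<lambda>n. (a - b) * ?t a (b + 1) n) sums ((a - b) * kummer_M a (b + 1) z)"
    using b by (intro sums_mult kummer_M_sums) auto
  ultimately show ?thesis
    by (metis sums_unique2)
qed

text \<open>The three orders involve only two reciprocal Gamma values up to polynomial factors.
  After that reduction the coefficients of these two values agree by the contiguous
  relations.\<close>

lemma hermite_H_rec:
  "hermite_H (\<nu> + 1) z = 2 * z * hermite_H \<nu> z - 2 * \<nu> * hermite_H (\<nu> - 1) z"
proof -
  define S where "S = complex_of_real (sqrt pi)"
  define T where "T = (2 :: complex) powr \<nu>"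
  have T: "2 powr (\<nu> + 1) = 2 * T" "2 powr (\<nu> + 1 + 1) = 4 * T" "2 powr (\<nu> - 1) = T / 2"
    by (simp_all add: T_def powr_add powr_diff)
  define r where "r = rGamma (- \<nu> / 2)"
  define q where "q = rGamma ((1 - \<nu>) / 2)"
  \<comment> \<open>Here \<open>r\<close> becomes a multiple of the value at order
    \<open>\<nu> - 1\<close>, not conversely, so nothing is divided by \<open>\<nu>\<close> and
    order 0 is covered.\<close>
  have r: "- \<nu> / 2 * rGamma ((1 - (\<nu> - 1)) / 2) = r"
    using rGamma_plus1[of "- \<nu> / 2"] by (simp add: r_def field_simps)
  have q: "rGamma (- (\<nu> + 1) / 2) = - (\<nu> + 1) / 2 * q"
    using rGamma_plus1[of "- (\<nu> + 1) / 2"] by (simp add: q_def field_simps)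
  define w where "w = z\<^sup>2"
  have K1: "kummer_M (- (\<nu> + 1) / 2) (1 / 2) w
      = kummer_M ((1 - \<nu>) / 2) (1 / 2) w - 2 * w * kummer_M ((1 - \<nu>) / 2) (3 / 2) w"
  proof -
    have e: "(1 - \<nu>) / 2 - 1 = - (\<nu> + 1) / 2" "1 / 2 + 1 = (3 / 2 :: complex)"
      by (simp_all add: field_simps)
    show ?thesis
      using kummer_M_contiguous_a[of "1 / 2" "(1 - \<nu>) / 2" w] unfolding e by simp
  qed
  have K2: "(\<nu> + 1) * kummer_M (- \<nu> / 2) (3 / 2) w
      = kummer_M (- \<nu> / 2) (1 / 2) w + \<nu> * kummer_M ((2 - \<nu>) / 2) (3 / 2) w"
  proof -
    have e: "- \<nu> / 2 + 1 = (2 - \<nu>) / 2" "1 / 2 + 1 = (3 / 2 :: complex)"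
      by (simp_all add: field_simps)
    have "(- \<nu> / 2 - 1 / 2) * kummer_M (- \<nu> / 2) (3 / 2) w
        = (- \<nu> / 2) * kummer_M ((2 - \<nu>) / 2) (3 / 2) w - 1 / 2 * kummer_M (- \<nu> / 2) (1 / 2) w"
      using kummer_M_contiguous_ab[of "1 / 2" "- \<nu> / 2" w] unfolding e by simp
    from arg_cong[OF this, of "(*) (- 2)"] show ?thesis
      by (simp add: algebra_simps)
  qed
  have n: "1 - (\<nu> + 1) = - \<nu>" "- (\<nu> - 1) = 1 - \<nu>" "1 - (\<nu> - 1) = 2 - \<nu>" "\<nu> - 1 + 1 = \<nu>"
    by simp_all
  define k1 k2 k3 k4 where "k1 = kummer_M ((1 - \<nu>) / 2) (1 / 2) w"
    and "k2 = kummer_M ((1 - \<nu>) / 2) (3 / 2) w" and "k3 = kummer_M (- \<nu> / 2) (1 / 2) w"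
    and "k4 = kummer_M ((2 - \<nu>) / 2) (3 / 2) w"
  define m where "m = kummer_M (- \<nu> / 2) (3 / 2) w"
  define r' where "r' = rGamma ((2 - \<nu>) / 2)"
  have K2': "(\<nu> + 1) * m = k3 + \<nu> * k4"
    using K2 by (simp add: m_def k3_def k4_def)
  have r': "r = - \<nu> / 2 * r'"
    using r by (simp add: r'_def)
  have h1: "hermite_H (\<nu> + 1) z
      = 2 * T * S * r * (k1 - 2 * w * k2) + 2 * T * S * q * z * ((\<nu> + 1) * m)"
    unfolding hermite_H_def w_def[symmetric] S_def[symmetric] n T q r_def[symmetric] K1
    by (simp add: k1_def k2_def m_def field_simps)
  have h2: "hermite_H \<nu> z = T * S * q * k3 - 2 * T * S * r * z * k2"
    unfolding hermite_H_def w_def[symmetric] S_def[symmetric] T q_def[symmetric] r_def[symmetric]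
    by (simp add: k3_def k2_def T_def)
  have h3: "hermite_H (\<nu> - 1) z = T / 2 * S * r' * k1 - T * S * q * z * k4"
    unfolding hermite_H_def w_def[symmetric] S_def[symmetric] n T q_def[symmetric] r'_def[symmetric]
    by (simp add: k1_def k4_def T_def)
  show ?thesis
    unfolding h1 h2 h3 K2' r' w_def by (simp add: field_simps power2_eq_square)
qed

text \<open>Polymorphic so that the same polynomials serve for real estimates and for the complex
  arguments of \<open>hermite_H\<close>, in particular the imaginary ones.\<close>

fun hermite_poly :: "nat \<Rightarrow> 'a::comm_ring_1 \<Rightarrow> 'a" where
  "hermite_poly 0 x = 1"
| "hermite_poly (Suc 0) x = 2 * x"
| "hermite_poly (Suc (Suc n)) x =
    2 * x * hermite_poly (Suc n) x - 2 * of_nat (Suc n) * hermite_poly n x"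

lemma kummer_M_0 [simp]: "kummer_M 0 b z = 1"
proof -
  have "(\<lambda>n. pochhammer 0 n * z ^ n / (pochhammer b n * fact n)) = (\<lambda>n. if n = 0 then 1 else 0)"
    by (auto simp: pochhammer_0_left)
  then have "(\<lambda>n. pochhammer 0 n * z ^ n / (pochhammer b n * fact n)) sums 1"
    by (simp add: sums_single[of 0 "\<lambda>_. 1"])
  then show ?thesis
    unfolding kummer_M_def by (rule sums_unique[symmetric])
qed

lemma rGamma_half: "rGamma (1 / 2 :: complex) = 1 / of_real (sqrt pi)"
  by (simp add: rGamma_inverse_Gamma Gamma_one_half_complex inverse_eq_divide)

text \<open>At orders 0 and 1 the zero of \<open>rGamma\<close> at 0 kills one of the two Kummer
  terms and the other series reduces to 1; \<open>hermite_H_rec\<close> does the rest.\<close>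

theorem hermite_H_of_nat: "hermite_H (of_nat n) z = hermite_poly n z"
proof (induction n z rule: hermite_poly.induct)
  case (3 n z)
  have "of_nat (Suc (Suc n)) = (of_nat (Suc n) + 1 :: complex)"
    "of_nat n = (of_nat (Suc n) - 1 :: complex)"
    by simp_all
  then show ?case
    using hermite_H_rec[of "of_nat (Suc n)" z] 3 by (simp del: of_nat_Suc)
next
  case (2 z)
  have "rGamma (- 1 / 2 :: complex) = - 1 / 2 * rGamma (1 / 2)"
    using rGamma_plus1[of "- 1 / 2 :: complex"] by simp
  then show ?case
    by (simp add: hermite_H_def rGamma_half powr_add)
qed (simp add: hermite_H_def rGamma_half)

lemma of_real_hermite_poly:
  "of_real (hermite_poly n x) = (hermite_poly n (of_real x) :: 'a :: {real_algebra_1, comm_ring_1})"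
  by (induction n x rule: hermite_poly.induct) auto

subsection \<open>Growth of the Hermite polynomials\<close>

lemma hermite_poly_minus: "hermite_poly n (- x) = (- 1) ^ n * hermite_poly n x"
  by (induction n x rule: hermite_poly.induct) (auto simp: algebra_simps)

text \<open>The predecessor is truncated at \<open>n = 0\<close>, where the factor \<open>n\<close> vanishes.\<close>

lemma hermite_poly_Suc:
  "hermite_poly (Suc n) x = 2 * x * hermite_poly n x - 2 * of_nat n * hermite_poly (n - 1) x"
  by (cases n) auto

lemma DERIV_hermite_poly:
  fixes x :: real
  shows "(hermite_poly n has_real_derivative 2 * n * hermite_poly (n - 1) x) (at x)"
proof (induction n x rule: hermite_poly.induct)
  case (1 x)
  have "hermite_poly 0 = (\<lambda>_. 1 :: real)"
    by (rule ext) simp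
  then show ?case by simp
next
  case (2 x)
  have "hermite_poly (Suc 0) = (\<lambda>x. 2 * x :: real)"
    by (rule ext) simp
  then show ?case
    by (auto intro!: derivative_eq_intros)
next
  case (3 n x)
  have "hermite_poly (Suc (Suc n))
      = (\<lambda>x :: real. 2 * x * hermite_poly (Suc n) x - 2 * of_nat (Suc n) * hermite_poly n x)"
    by (rule ext) simp
  moreover have "((\<lambda>x. 2 * x * hermite_poly (Suc n) x - 2 * of_nat (Suc n) * hermite_poly n x)
      has_real_derivative 2 * hermite_poly (Suc n) x + 2 * x * (2 * Suc n * hermite_poly n x)
        - 2 * of_nat (Suc n) * (2 * n * hermite_poly (n - 1) x)) (at x)"
    using 3 by (auto intro!: derivative_eq_intros simp: algebra_simps)
  moreover have "2 * hermite_poly (Suc n) x + 2 * x * (2 * Suc n * hermite_poly n x)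
        - 2 * of_nat (Suc n) * (2 * n * hermite_poly (n - 1) x)
      = 2 * Suc (Suc n) * hermite_poly (Suc n) x"
    unfolding hermite_poly_Suc[of n x] by (simp add: algebra_simps)
  ultimately show ?case by simp
qed

text \<open>Odd degrees vanish at 0. For \<open>n = 2 * m\<close> the left side is the central
  binomial coefficient over 4^m, so the order n^(-1/2) is sharp. A step of two multiplies it by (n +
  1) / (n + 2).\<close>

lemma hermite_poly_0_squared_le:
  "(hermite_poly n 0 :: real)\<^sup>2 / (2 ^ n * fact n) \<le> 1 / sqrt (n + 1)"
proof (induction n rule: induct_nat_012)
  case 0
  show ?case by simp
next
  case 1
  show ?case by simp
next
  case (ge2 n)
  have "(hermite_poly (Suc (Suc n)) 0 :: real)\<^sup>2 / (2 ^ Suc (Suc n) * fact (Suc (Suc n)))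
      = (n + 1) / (n + 2) * ((hermite_poly n 0)\<^sup>2 / (2 ^ n * fact n))"
    by (simp add: power2_eq_square divide_simps) (simp add: algebra_simps)
  also have "\<dots> \<le> (n + 1) / (n + 2) * (1 / sqrt (n + 1))"
    using ge2 by (intro mult_left_mono) auto
  also have "\<dots> = (n + 1) / sqrt (n + 1) / (n + 2)"
    by simp
  also have "\<dots> = sqrt (n + 1) / (n + 2)"
    by (subst real_div_sqrt) auto
  also have "\<dots> \<le> 1 / sqrt (n + 3)"
  proof -
    have "sqrt (n + 1) * sqrt (n + 3) = sqrt ((n + 1) * (n + 3))"
      by (simp only: real_sqrt_mult of_nat_mult)
    also have "\<dots> \<le> n + 2"
      by (intro real_le_lsqrt) (auto simp: power2_eq_square algebra_simps)
    finally show ?thesis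
      by (simp add: field_simps)
  qed
  finally show ?case
    by (simp add: add.commute)
qed

text \<open>Sonin's argument: for \<open>h = exp (- t\<^sup>2 / 2) * hermite_poly n t\<close>, which satisfies
  \<open>h'' + (2 * real n + 1 - t\<^sup>2) * h = 0\<close>, the function \<open>h'\<^sup>2 + (2 * real n + 1 - t\<^sup>2) * h\<^sup>2\<close> has derivative
  \<open>- 2 * t * h\<^sup>2\<close>.\<close>

lemma hermite_poly_sonin:
  fixes x :: real
  assumes x: "x \<ge> 0"
  shows "(2 * real n + 1 - x\<^sup>2) * (exp (- x\<^sup>2) * (hermite_poly n x)\<^sup>2)
    \<le> (2 * n * hermite_poly (n - 1) (0 :: real))\<^sup>2 + (2 * real n + 1) * (hermite_poly n (0 :: real))\<^sup>2"
proof -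
  define H where "H = (hermite_poly n :: real \<Rightarrow> real)"
  \<comment> \<open>With \<open>h\<close> as in Sonin's argument,
    \<open>h' = exp (- t\<^sup>2 / 2) * G t\<close>, so \<open>E\<close> is the monotone function of
    that argument.\<close>
  define G where "G = (\<lambda>t :: real. 2 * n * hermite_poly (n - 1) t - t * H t)"
  define E where "E = (\<lambda>t :: real. exp (- t\<^sup>2) * ((G t)\<^sup>2 + (2 * real n + 1 - t\<^sup>2) * (H t)\<^sup>2))"
  have dH: "(H has_real_derivative G t + t * H t) (at t)" for t
    using DERIV_hermite_poly[of n t] by (simp add: H_def G_def)
  have dG: "(G has_real_derivative t * G t - (2 * real n + 1 - t\<^sup>2) * H t) (at t)" for t :: real
  proof (cases n)
    case 0
    have "G = (\<lambda>t. - t)" "H = (\<lambda>_. 1)"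
      unfolding G_def H_def 0 by (rule ext; simp)+
    then show ?thesis
      by (auto intro!: derivative_eq_intros simp: 0 power2_eq_square)
  next
    case (Suc m)
    have "((\<lambda>t. 2 * n * hermite_poly m t - t * H t) has_real_derivative
        2 * n * (2 * m * hermite_poly (m - 1) t) - (H t + t * (G t + t * H t))) (at t)"
      by (auto intro!: derivative_eq_intros dH DERIV_hermite_poly)
    moreover have e: "2 * m * hermite_poly (m - 1) t = 2 * t * hermite_poly m t - H t"
      using hermite_poly_Suc[of m t] by (simp add: H_def Suc)
    moreover have G: "G = (\<lambda>t :: real. 2 * n * hermite_poly m t - t * H t)"
      by (simp add: G_def Suc)
    moreover have "2 * n * (2 * m * hermite_poly (m - 1) t) - (H t + t * (G t + t * H t))
        = t * G t - (2 * real n + 1 - t\<^sup>2) * H t"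
      unfolding e G by (simp add: algebra_simps power2_eq_square)
    ultimately show ?thesis
      by metis
  qed
  have dE: "(E has_real_derivative - 2 * t * (exp (- t\<^sup>2) * (H t)\<^sup>2)) (at t)" for t
    unfolding E_def
    by (auto intro!: derivative_eq_intros dH dG simp: power2_eq_square algebra_simps)
  have "E x \<le> E 0"
  proof (rule DERIV_nonpos_imp_nonincreasing[OF x])
    fix t :: real
    assume "0 \<le> t"
    then show "\<exists>d. (E has_real_derivative d) (at t) \<and> d \<le> 0"
      by (intro exI[of _ "- 2 * t * (exp (- t\<^sup>2) * (H t)\<^sup>2)"] conjI dE) simp
  qed
  moreover have "(2 * real n + 1 - x\<^sup>2) * (exp (- x\<^sup>2) * (H x)\<^sup>2) \<le> E x"
    by (simp add: E_def algebra_simps)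
  moreover have "E 0 = (2 * real n * hermite_poly (n - 1) (0 :: real))\<^sup>2 + (2 * real n + 1) * (hermite_poly n 0)\<^sup>2"
    by (simp add: E_def G_def H_def)
  ultimately show ?thesis
    unfolding H_def by linarith
qed

text \<open>For \<open>x\<^sup>2 \<le> n\<close> the factor in Sonin's inequality is at least n + 1,
  while its right side, after normalisation, is at most \<open>4 * sqrt (n + 1)\<close> by the
  values at 0.\<close>

lemma hermite_poly_bound_large:
  fixes x :: real
  assumes n: "x\<^sup>2 \<le> n"
  shows "(hermite_poly n x)\<^sup>2 / (2 ^ n * fact n) \<le> 4 * exp (x\<^sup>2) / sqrt (n + 1)"
proof -
  have "(hermite_poly n x)\<^sup>2 = (hermite_poly n \<bar>x\<bar>)\<^sup>2"
    by (auto simp: abs_if hermite_poly_minus power_mult_distrib simp flip: power_mult)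
  define d where "d = (\<lambda>n. (hermite_poly n 0 :: real)\<^sup>2 / (2 ^ n * fact n))"
  have pos: "2 ^ n * fact n > (0 :: real)"
    by simp
  have "(n + 1) * (exp (- x\<^sup>2) * (hermite_poly n \<bar>x\<bar>)\<^sup>2)
      \<le> (2 * real n + 1 - x\<^sup>2) * (exp (- x\<^sup>2) * (hermite_poly n \<bar>x\<bar>)\<^sup>2)"
    using n by (intro mult_right_mono) auto
  also have "\<dots> \<le> (2 * n * hermite_poly (n - 1) (0 :: real))\<^sup>2 + (2 * real n + 1) * (hermite_poly n (0 :: real))\<^sup>2"
    using hermite_poly_sonin[of "\<bar>x\<bar>" n] by simp
  finally have "(n + 1) * (exp (- x\<^sup>2) * (hermite_poly n \<bar>x\<bar>)\<^sup>2) / (2 ^ n * fact n)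
      \<le> ((2 * n * hermite_poly (n - 1) (0 :: real))\<^sup>2 + (2 * real n + 1) * (hermite_poly n (0 :: real))\<^sup>2) / (2 ^ n * fact n)"
    by (intro divide_right_mono) auto
  also have "\<dots> = 2 * n * d (n - 1) + (2 * real n + 1) * d n"
  proof (cases n)
    case (Suc m)
    have "(2 * k * p)\<^sup>2 / (2 * k * W) = 2 * k * (p\<^sup>2 / W)" if "k > 0" "W > 0" for k p W :: real
      using that by (simp add: power2_eq_square)
    from this[of "real n" "2 ^ m * fact m" "hermite_poly m 0"]
    have "(2 * n * hermite_poly (n - 1) (0 :: real))\<^sup>2 / (2 * real n * (2 ^ m * fact m)) = 2 * n * d (n - 1)"
      by (simp add: Suc d_def)
    moreover have "2 * real n * (2 ^ m * fact m) = 2 ^ n * fact n"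
      by (simp add: Suc)
    ultimately show ?thesis
      by (simp add: d_def add_divide_distrib)
  qed (simp add: d_def)
  also have "\<dots> \<le> 4 * sqrt (n + 1)"
  proof -
    have "2 * n * d (n - 1) \<le> 2 * sqrt (n + 1)"
    proof (cases n)
      case (Suc m)
      have "2 * real n * d m \<le> 2 * real n * (1 / sqrt n)"
        using hermite_poly_0_squared_le[of m] by (intro mult_left_mono) (auto simp: d_def Suc add.commute)
      also have "\<dots> = 2 * (n / sqrt n)"
        by simp
      also have "n / sqrt n = sqrt n"
        by (intro real_div_sqrt) simp
      finally show ?thesis
        by (simp add: Suc) (smt (verit) real_sqrt_le_iff)
    qed simp
    moreover have "(2 * real n + 1) * d n \<le> 2 * sqrt (n + 1)"
    proof -
      have "(2 * real n + 1) * d n \<le> (2 * (n + 1)) * (1 / sqrt (n + 1))"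
        using hermite_poly_0_squared_le[of n] by (intro mult_mono) (auto simp: d_def)
      also have "\<dots> = 2 * ((real n + 1) / sqrt (real n + 1))"
        by (simp add: add_divide_distrib add.commute)
      also have "(real n + 1) / sqrt (real n + 1) = sqrt (real n + 1)"
        by (intro real_div_sqrt) simp
      finally show ?thesis by (simp add: add.commute)
    qed
    ultimately show ?thesis by linarith
  qed
  finally have "(n + 1) * (exp (- x\<^sup>2) * ((hermite_poly n \<bar>x\<bar>)\<^sup>2 / (2 ^ n * fact n)))
      \<le> 4 * sqrt (n + 1)"
    by simp
  then have "exp (- x\<^sup>2) * ((hermite_poly n \<bar>x\<bar>)\<^sup>2 / (2 ^ n * fact n)) \<le> 4 * sqrt (n + 1) / (n + 1)"
    by (simp add: field_simps)
  also have "\<dots> = 4 / sqrt (n + 1)"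
    by (simp add: field_simps)
  finally show ?thesis
    using \<open>(hermite_poly n x)\<^sup>2 = (hermite_poly n \<bar>x\<bar>)\<^sup>2\<close>
    by (simp add: exp_minus field_simps)
qed

section \<open>Coefficients of Mehler's series: decay and bounded partial sums\<close>

definition mehler_coeff :: "real \<Rightarrow> real \<Rightarrow> nat \<Rightarrow> real" where
  "mehler_coeff x y n = hermite_poly n x * hermite_poly n y / (2 ^ n * fact n)"

lemma mehler_coeff_minus: "mehler_coeff x (- y) n = (- 1) ^ n * mehler_coeff x y n"
  by (simp add: mehler_coeff_def hermite_poly_minus)

lemma mehler_coeff_diag: "mehler_coeff x x n = (hermite_poly n x)\<^sup>2 / (2 ^ n * fact n)"
  by (simp add: mehler_coeff_def power2_eq_square)

lemma mehler_coeff_diag_bound: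
  "\<exists>C\<ge>0. \<forall>n. mehler_coeff x x n \<le> C / sqrt (n + 1)"
proof -
  define N where "N = nat \<lceil>x\<^sup>2\<rceil>"
  define f where "f = (\<lambda>n. mehler_coeff x x n * sqrt (n + 1))"
  define C where "C = 4 * exp (x\<^sup>2) + (\<Sum>n<N. f n)"
  have f0: "f n \<ge> 0" for n
    by (simp add: f_def mehler_coeff_diag)
  have "f n \<le> C" for n
  proof (cases "n < N")
    case True
    then have "f n \<le> (\<Sum>n<N. f n)"
      using f0 by (intro member_le_sum) auto
    then show ?thesis
      by (simp add: C_def add.commute add_increasing2)
  next
    case False
    then have "x\<^sup>2 \<le> n"
      by (simp add: N_def) linarith
    then have "f n \<le> 4 * exp (x\<^sup>2)"
      using hermite_poly_bound_large[of x n]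
      by (simp add: f_def mehler_coeff_diag field_simps)
    then show ?thesis
      using f0 by (simp add: C_def add_increasing2 sum_nonneg)
  qed
  moreover from this[of 0] have "C \<ge> 0"
    using f0[of 0] by linarith
  ultimately show ?thesis
    by (intro exI[of _ C]) (auto simp: f_def field_simps)
qed

lemma abs_mehler_coeff_le:
  "\<bar>mehler_coeff x y n\<bar> \<le> (mehler_coeff x x n + mehler_coeff y y n) / 2"
proof -
  have "\<bar>hermite_poly n x * hermite_poly n y\<bar>
      \<le> ((hermite_poly n x)\<^sup>2 + (hermite_poly n y)\<^sup>2) / 2"
    using sum_squares_bound[of "\<bar>hermite_poly n x\<bar>" "\<bar>hermite_poly n y\<bar>"]
    by (simp add: abs_mult)
  then show ?thesis
    unfolding mehler_coeff_diag
    by (simp add: mehler_coeff_def abs_mult divide_simps)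
qed

lemma abs_mehler_coeff_bounded: "\<exists>C\<ge>0. \<forall>n. \<bar>mehler_coeff x y n\<bar> \<le> C"
proof -
  obtain C D where C: "C \<ge> 0" "\<And>n. mehler_coeff x x n \<le> C / sqrt (n + 1)"
    and D: "D \<ge> 0" "\<And>n. mehler_coeff y y n \<le> D / sqrt (n + 1)"
    using mehler_coeff_diag_bound[of x] mehler_coeff_diag_bound[of y] by auto
  have "E / sqrt (n + 1) \<le> E" if "E \<ge> 0" for E :: real and n :: nat
    using divide_left_mono[of 1 "sqrt (n + 1)" E] that by simp
  with C D have "\<bar>mehler_coeff x y n\<bar> \<le> (C + D) / 2" for n
    using abs_mehler_coeff_le[of x y n] by (smt (verit, best) divide_right_mono)
  with C D show ?thesis
    by (intro exI[of _ "(C + D) / 2"]) auto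
qed

text \<open>The three-term recurrence makes the sum telescope. It captures the cancellation between
  terms when \<open>x \<noteq> y\<close>, which bounds on single terms cannot see.\<close>

lemma christoffel_darboux:
  "(\<Sum>n<Suc N. mehler_coeff x y n) * (x - y)
    = (hermite_poly (Suc N) x * hermite_poly N y - hermite_poly N x * hermite_poly (Suc N) y)
        / (2 ^ Suc N * fact N)"
proof (induction N)
  case 0
  show ?case by (simp add: mehler_coeff_def)
next
  case (Suc N)
  have "(\<Sum>n<Suc (Suc N). mehler_coeff x y n) * (x - y)
      = (\<Sum>n<Suc N. mehler_coeff x y n) * (x - y) + mehler_coeff x y (Suc N) * (x - y)"
    by (simp add: distrib_right)
  also have "\<dots> = ((hermite_poly (Suc N) x * hermite_poly N y - hermite_poly N x * hermite_poly (Suc N) y)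
        * (2 * real (Suc N)) + hermite_poly (Suc N) x * hermite_poly (Suc N) y * (2 * (x - y)))
      / (2 ^ Suc (Suc N) * fact (Suc N))"
  proof -
    have "a / (2 ^ Suc N * fact N) + p / (2 ^ Suc N * fact (Suc N)) * q
        = (a * (2 * real (Suc N)) + p * (2 * q)) / (2 ^ Suc (Suc N) * fact (Suc N))" for a p q :: real
      unfolding add_divide_distrib by (simp add: field_simps del: of_nat_Suc)
    then show ?thesis
      unfolding Suc.IH unfolding mehler_coeff_def .
  qed
  also have "(hermite_poly (Suc N) x * hermite_poly N y - hermite_poly N x * hermite_poly (Suc N) y)
        * (2 * real (Suc N)) + hermite_poly (Suc N) x * hermite_poly (Suc N) y * (2 * (x - y))
      = hermite_poly (Suc (Suc N)) x * hermite_poly (Suc N) y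
      - hermite_poly (Suc N) x * hermite_poly (Suc (Suc N)) y"
    by (simp add: algebra_simps)
  finally show ?case .
qed

text \<open>Squaring a product in the Christoffel-Darboux numerator leaves a factor (N + 1) / 2 from
  the normalisations. The two diagonal coefficients, each of order (N + 1)^(-1/2), compensate it
  exactly.\<close>

lemma mehler_coeff_partial_sums_bounded:
  assumes "x \<noteq> y"
  shows "\<exists>K\<ge>0. \<forall>N. \<bar>\<Sum>n<N. mehler_coeff x y n\<bar> \<le> K"
proof -
  obtain C D where C: "C \<ge> 0" "\<And>n. mehler_coeff x x n \<le> C / sqrt (n + 1)"
    and D: "D \<ge> 0" "\<And>n. mehler_coeff y y n \<le> D / sqrt (n + 1)"
    using mehler_coeff_diag_bound[of x] mehler_coeff_diag_bound[of y] by auto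
  have prod: "\<bar>hermite_poly (Suc N) u * hermite_poly N v / (2 ^ Suc N * fact N)\<bar> \<le> sqrt (E * F)"
    if "E \<ge> 0" "F \<ge> 0" "\<And>n. mehler_coeff u u n \<le> E / sqrt (n + 1)"
      "\<And>n. mehler_coeff v v n \<le> F / sqrt (n + 1)" for u v E F N
  proof -
    have "(hermite_poly (Suc N) u * hermite_poly N v / (2 ^ Suc N * fact N))\<^sup>2
        = mehler_coeff u u (Suc N) * mehler_coeff v v N * (real (Suc N) / 2)"
      unfolding mehler_coeff_diag
      by (simp add: power2_eq_square divide_simps del: of_nat_Suc hermite_poly.simps)
    also have "\<dots> \<le> (E / sqrt (N + 1)) * (F / sqrt (N + 1)) * (N + 1)"
    proof (intro mult_mono)
      have "mehler_coeff u u (Suc N) \<le> E / sqrt (Suc N + 1)"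
        by (rule that)
      also have "\<dots> \<le> E / sqrt (N + 1)"
        using that by (intro divide_left_mono) auto
      finally show "mehler_coeff u u (Suc N) \<le> E / sqrt (N + 1)" .
    qed (use that in \<open>auto simp: mehler_coeff_diag\<close>)
    also have "\<dots> = E * F"
      by (simp add: field_simps)
    finally have "sqrt ((hermite_poly (Suc N) u * hermite_poly N v / (2 ^ Suc N * fact N))\<^sup>2)
        \<le> sqrt (E * F)"
      by (rule real_sqrt_le_mono)
    then show ?thesis
      by (simp only: real_sqrt_abs)
  qed
  define K where "K = 2 * sqrt (C * D) / \<bar>x - y\<bar>"
  have "\<bar>\<Sum>n<N. mehler_coeff x y n\<bar> \<le> K" for N
  proof (cases N)
    case (Suc M)
    have "\<bar>\<Sum>n<N. mehler_coeff x y n\<bar> * \<bar>x - y\<bar>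
        = \<bar>hermite_poly (Suc M) x * hermite_poly M y / (2 ^ Suc M * fact M)
          - hermite_poly (Suc M) y * hermite_poly M x / (2 ^ Suc M * fact M)\<bar>"
      unfolding Suc abs_mult[symmetric] christoffel_darboux
      by (simp add: diff_divide_distrib mult.commute del: hermite_poly.simps)
    also have "\<dots> \<le> sqrt (C * D) + sqrt (D * C)"
      using prod[OF C(1) D(1) C(2) D(2), of M] prod[OF D(1) C(1) D(2) C(2), of M] by linarith
    finally show ?thesis
      using assms by (simp add: K_def field_simps)
  qed (use C D in \<open>auto simp: K_def\<close>)
  moreover have "K \<ge> 0"
    using C D by (simp add: K_def)
  ultimately show ?thesis by auto
qed

text \<open>The bound does not depend on \<open>r\<close>. With \<open>r = tanh u\<close> it
  therefore yields a majorant that is uniform in \<open>u\<close>, even as \<open>tanh u\<close>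
  tends to 1.\<close>

lemma abel_partial_sums_bound:
  fixes c :: "nat \<Rightarrow> real"
  assumes K: "\<And>N. \<bar>\<Sum>n<N. c n\<bar> \<le> K" and r: "0 \<le> r" "r \<le> 1"
  shows "\<bar>\<Sum>n<N. c n * r ^ n\<bar> \<le> K"
proof -
  define T where "T = (\<lambda>N. \<Sum>n<N. c n)"
  \<comment> \<open>Summation by parts: the weights \<open>r ^ n - r ^ Suc n\<close> and
    \<open>r ^ N\<close> are nonnegative and add up to 1.\<close>
  have "(\<Sum>n<N. c n * r ^ n) = (\<Sum>n<N. T (Suc n) * (r ^ n - r ^ Suc n)) + T N * r ^ N"
    by (induction N) (auto simp: T_def algebra_simps)
  also have "\<bar>\<dots>\<bar> \<le> (\<Sum>n<N. K * (r ^ n - r ^ Suc n)) + K * r ^ N"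
  proof (rule order.trans[OF abs_triangle_ineq add_mono])
    have le: "r ^ Suc n \<le> r ^ n" for n
      using r by (intro power_decreasing) auto
    show "\<bar>\<Sum>n<N. T (Suc n) * (r ^ n - r ^ Suc n)\<bar> \<le> (\<Sum>n<N. K * (r ^ n - r ^ Suc n))"
    proof (rule order.trans[OF sum_abs sum_mono])
      fix n
      show "\<bar>T (Suc n) * (r ^ n - r ^ Suc n)\<bar> \<le> K * (r ^ n - r ^ Suc n)"
        using le[of n] K[of "Suc n"] unfolding abs_mult T_def
        by (intro mult_mono) auto
    qed
    show "\<bar>T N * r ^ N\<bar> \<le> K * r ^ N"
      using K[of N] r by (simp add: abs_mult T_def mult_right_mono)
  qed
  also have "(\<Sum>n<N. K * (r ^ n - r ^ Suc n)) = K * (1 - r ^ N)"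
    by (simp add: sum_distrib_left[symmetric] sum_lessThan_telescope' del: power_Suc)
  finally show ?thesis
    by (simp add: algebra_simps)
qed

subsection \<open>Mehler's formula\<close>

lemma sums_shift_power:
  fixes r :: "'a :: real_normed_field"
  assumes "(\<lambda>n. c n * r ^ n) sums s"
  shows "(\<lambda>n. (if n = 0 then 0 else c (n - 1)) * r ^ n) sums (r * s)"
proof -
  have "(\<lambda>n. r * (c n * r ^ n)) sums (r * s)"
    by (intro sums_mult assms)
  then show ?thesis
    using sums_Suc_iff[of "\<lambda>n. (if n = 0 then 0 else c (n - 1)) * r ^ n" "r * s"]
    by (simp add: mult_ac)
qed

definition mehler_kernel :: "real \<Rightarrow> real \<Rightarrow> real \<Rightarrow> real" where
  "mehler_kernel x y r =
     exp ((2 * r * x * y - r\<^sup>2 * (x\<^sup>2 + y\<^sup>2)) / (1 - r\<^sup>2)) / sqrt (1 - r\<^sup>2)"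

lemma DERIV_mehler_kernel:
  assumes "\<bar>r\<bar> < 1"
  shows "(mehler_kernel x y has_real_derivative
    (2 * (x - r * y) * (y - r * x) / (1 - r\<^sup>2)\<^sup>2 + r / (1 - r\<^sup>2)) * mehler_kernel x y r) (at r)"
proof -
  have pos: "1 - r\<^sup>2 > 0"
    using assms by (simp add: abs_square_less_1)
  define Q where "Q = (\<lambda>r. (2 * r * x * y - r\<^sup>2 * (x\<^sup>2 + y\<^sup>2)) / (1 - r\<^sup>2))"
  have "(Q has_real_derivative 2 * (x - r * y) * (y - r * x) / (1 - r\<^sup>2)\<^sup>2) (at r)"
    unfolding Q_def using pos
    by (auto intro!: derivative_eq_intros simp: divide_simps power2_eq_square) (simp add: algebra_simps)
  moreover have "((\<lambda>r. sqrt (1 - r\<^sup>2)) has_real_derivative - (r / sqrt (1 - r\<^sup>2))) (at r)"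
    using pos by (auto intro!: derivative_eq_intros simp: field_simps)
  ultimately have "((\<lambda>r. exp (Q r) / sqrt (1 - r\<^sup>2)) has_real_derivative
      (exp (Q r) * (2 * (x - r * y) * (y - r * x) / (1 - r\<^sup>2)\<^sup>2) * sqrt (1 - r\<^sup>2)
        - exp (Q r) * - (r / sqrt (1 - r\<^sup>2))) / (sqrt (1 - r\<^sup>2) * sqrt (1 - r\<^sup>2))) (at r)"
    using pos by (intro DERIV_divide DERIV_fun_exp) auto
  moreover have "(exp (Q r) * d * sqrt (1 - r\<^sup>2) - exp (Q r) * - (r / sqrt (1 - r\<^sup>2)))
        / (sqrt (1 - r\<^sup>2) * sqrt (1 - r\<^sup>2))
      = (d + r / (1 - r\<^sup>2)) * (exp (Q r) / sqrt (1 - r\<^sup>2))" for d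
  proof -
    define s where "s = sqrt (1 - r\<^sup>2)"
    have s: "s > 0" "1 - r\<^sup>2 = s * s"
      using pos by (auto simp: s_def)
    show ?thesis
      unfolding s(2) using s(1) by (simp add: field_simps)
  qed
  moreover have "mehler_kernel x y = (\<lambda>r. exp (Q r) / sqrt (1 - r\<^sup>2))"
    by (simp add: fun_eq_iff mehler_kernel_def Q_def)
  ultimately show ?thesis
    by (simp only:)
qed

text \<open>Series and kernel satisfy the same first-order linear differential equation in
  \<open>r\<close> and both equal 1 at 0, so their quotient is constant. For the series the equation
  follows from the Hermite recurrence alone.\<close>

theorem mehler_formula:
  assumes r: "\<bar>r\<bar> < 1"
  shows "(\<lambda>n. mehler_coeff x y n * r ^ n) sums mehler_kernel x y r"
proof -
  have summable: "summable (\<lambda>n. mehler_coeff u v n * s ^ n)" if s: "norm s < 1" for u v s :: real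
  proof -
    obtain C where C: "C \<ge> 0" "\<And>n. \<bar>mehler_coeff u v n\<bar> \<le> C"
      using abs_mehler_coeff_bounded[of u v] by auto
    show ?thesis
    proof (rule summable_comparison_test')
      show "summable (\<lambda>n. C * \<bar>s\<bar> ^ n)"
        using s by (intro summable_mult summable_geometric) auto
      show "norm (mehler_coeff u v n * s ^ n) \<le> C * \<bar>s\<bar> ^ n" for n
        using C by (auto simp: abs_mult power_abs intro!: mult_right_mono)
    qed
  qed
  define w where "w = (\<lambda>n. 2 ^ n * fact n :: real)"
  have w: "w n > 0" "w (Suc n) = 2 * real (Suc n) * w n" for n
    by (simp_all add: w_def)
  have mc: "mehler_coeff u v n = hermite_poly n u * hermite_poly n v / w n" for u v n
    by (simp add: mehler_coeff_def w_def)
  have diffs: "diffs (mehler_coeff u v) n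
      = hermite_poly (Suc n) u * hermite_poly (Suc n) v / (2 * w n)" for u v n
    using w(1)[of n]
    by (simp add: diffs_def mc w(2) field_simps del: hermite_poly.simps of_nat_Suc)
  have summable': "summable (\<lambda>n. diffs (mehler_coeff u v) n * s ^ n)" if "norm s < 1" for u v s :: real
    using termdiff_converges[of s 1 "mehler_coeff u v"] summable that by blast
  \<comment> \<open>Products of neighbouring degrees. Their generating functions
    \<open>B x y\<close> and \<open>B y x\<close> are auxiliary unknowns, to be eliminated between
    \<open>rec1\<close> and \<open>rec2\<close>.\<close>
  define b where "b = (\<lambda>u v n. hermite_poly (Suc n) u * hermite_poly n v / w n)"
  have summable_b: "summable (\<lambda>n. b u v n * s ^ n)" if s: "norm s < 1" for u v s :: real
  proof (rule summable_comparison_test')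
    show "summable (\<lambda>n. diffs (mehler_coeff u u) n * \<bar>s\<bar> ^ n + mehler_coeff v v n * \<bar>s\<bar> ^ n)"
      using s by (intro summable_add summable summable') auto
    fix n
    have "2 * \<bar>hermite_poly (Suc n) u * hermite_poly n v\<bar>
        \<le> (hermite_poly (Suc n) u)\<^sup>2 + (hermite_poly n v)\<^sup>2"
      using sum_squares_bound[of "\<bar>hermite_poly (Suc n) u\<bar>" "\<bar>hermite_poly n v\<bar>"]
      by (simp add: abs_mult del: hermite_poly.simps)
    then have "\<bar>b u v n\<bar> \<le> diffs (mehler_coeff u u) n + mehler_coeff v v n"
      unfolding diffs using w(1)[of n]
      by (simp add: b_def mc field_simps power2_eq_square abs_mult del: hermite_poly.simps,
          use zero_le_square[of "hermite_poly n v"] in linarith)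
    then show "norm (b u v n * s ^ n)
        \<le> diffs (mehler_coeff u u) n * \<bar>s\<bar> ^ n + mehler_coeff v v n * \<bar>s\<bar> ^ n"
      using mult_right_mono[of "\<bar>b u v n\<bar>" "diffs (mehler_coeff u u) n + mehler_coeff v v n" "\<bar>s\<bar> ^ n"]
      by (simp add: abs_mult power_abs distrib_right)
  qed
  define A A' B where "A = (\<lambda>s. \<Sum>n. mehler_coeff x y n * s ^ n)"
    and "A' = (\<lambda>s. \<Sum>n. diffs (mehler_coeff x y) n * s ^ n)"
    and "B = (\<lambda>u v s. \<Sum>n. b u v n * s ^ n)"
  have A: "(\<lambda>n. mehler_coeff x y n * s ^ n) sums A s"
    and A': "(\<lambda>n. diffs (mehler_coeff x y) n * s ^ n) sums A' s"
    and B: "(\<lambda>n. b u v n * s ^ n) sums B u v s" if "norm s < 1" for s u v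
    using summable summable' summable_b that by (auto simp: A_def A'_def B_def intro: summable_sums)
  have rec1: "B u v s = 2 * u * A s - s * B v u s"
    if s: "norm s < 1" and uv: "u = x \<and> v = y \<or> u = y \<and> v = x" for s u v
  proof (rule sums_unique2[OF B[OF s]])
    have "(\<lambda>n. 2 * u * (mehler_coeff x y n * s ^ n) - (if n = 0 then 0 else b v u (n - 1)) * s ^ n)
        sums (2 * u * A s - s * B v u s)"
      by (intro sums_diff sums_mult sums_shift_power A B s)
    moreover have "2 * u * (mehler_coeff x y n * s ^ n)
        - (if n = 0 then 0 else b v u (n - 1)) * s ^ n = b u v n * s ^ n" for n
    proof -
      have "2 * u * mehler_coeff x y n - (if n = 0 then 0 else b v u (n - 1)) = b u v n"
      proof (cases n)
        case 0
        then show ?thesis by (simp add: b_def mehler_coeff_def w_def)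
      next
        case (Suc m)
        have e: "mehler_coeff x y n = hermite_poly n u * hermite_poly n v / w n"
          using uv by (auto simp: mehler_coeff_def w_def)
        have "2 * u * (p1 * q1 / (2 * k * W)) - q1 * p0 / W = (2 * u * p1 - 2 * k * p0) * q1 / (2 * k * W)"
          if "k > 0" "W > 0" for k W p0 p1 q1 :: real
          using that by (simp add: field_simps)
        from this[of "real (Suc m)" "w m"] show ?thesis
          using w(1)[of m] unfolding e unfolding b_def Suc w(2) by simp
      qed
      from arg_cong[OF this, of "\<lambda>t. t * s ^ n"] show ?thesis
        by (simp add: left_diff_distrib mult.assoc)
    qed
    ultimately show "(\<lambda>n. b u v n * s ^ n) sums (2 * u * A s - s * B v u s)"
      by simp
  qed
  \<comment> \<open>The recurrence is applied to the factor in \<open>y\<close> and then, in the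
    remainder, to the factor in \<open>x\<close>. The last summand is \<open>2 * s\<close> times the
    derivative of \<open>s * A s\<close>, whose coefficients are \<open>g\<close>.\<close>
  have rec2: "2 * A' s = 2 * y * B x y s - 2 * x * (s * B x y s) + 2 * (s * (A s + s * A' s))"
    if s: "norm s < 1" for s
  proof -
    define g where "g = (\<lambda>n. mehler_coeff x y n
        + (if n = 0 then 0 else diffs (mehler_coeff x y) (n - 1)))"
    have g: "(\<lambda>n. g n * s ^ n) sums (A s + s * A' s)"
      unfolding g_def distrib_right by (intro sums_add sums_shift_power A A' s)
    have g_eq: "g n = real (Suc n) * mehler_coeff x y n" for n
      by (cases n) (auto simp: g_def diffs_def algebra_simps)
    have "(\<lambda>n. 2 * y * (b x y n * s ^ n) - 2 * x * ((if n = 0 then 0 else b x y (n - 1)) * s ^ n)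
          + 2 * ((if n = 0 then 0 else g (n - 1)) * s ^ n))
        sums (2 * y * B x y s - 2 * x * (s * B x y s) + 2 * (s * (A s + s * A' s)))"
      by (intro sums_add sums_diff sums_mult sums_shift_power A B g s)
    moreover have "2 * y * (b x y n * s ^ n) - 2 * x * ((if n = 0 then 0 else b x y (n - 1)) * s ^ n)
          + 2 * ((if n = 0 then 0 else g (n - 1)) * s ^ n)
        = 2 * (diffs (mehler_coeff x y) n * s ^ n)" for n
    proof -
      have "2 * y * b x y n - 2 * x * (if n = 0 then 0 else b x y (n - 1))
          + 2 * (if n = 0 then 0 else g (n - 1)) = 2 * diffs (mehler_coeff x y) n"
      proof (cases n)
        case 0
        then show ?thesis by (simp add: b_def diffs w_def)
      next
        case (Suc m)
        have "2 * y * ((2 * x * p1 - 2 * k * p0) * q1 / (2 * k * W)) - 2 * x * (p1 * q0 / W)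
            + 2 * (k * (p0 * q0 / W))
            = 2 * ((2 * x * p1 - 2 * k * p0) * (2 * y * q1 - 2 * k * q0) / (2 * (2 * k * W)))"
          if "k > 0" "W > 0" for k W p0 p1 q0 q1 :: real
          using that by (simp add: field_simps)
        from this[of "real (Suc m)" "w m"] show ?thesis
          using w(1)[of m] unfolding diffs g_eq b_def mc Suc w(2) by simp
      qed
      from arg_cong[OF this, of "\<lambda>t. t * s ^ n"] show ?thesis
        by (simp add: algebra_simps)
    qed
    ultimately have "(\<lambda>n. 2 * (diffs (mehler_coeff x y) n * s ^ n))
        sums (2 * y * B x y s - 2 * x * (s * B x y s) + 2 * (s * (A s + s * A' s)))"
      by simp
    moreover have "(\<lambda>n. 2 * (diffs (mehler_coeff x y) n * s ^ n)) sums (2 * A' s)"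
      by (intro sums_mult A' s)
    ultimately show ?thesis
      by (rule sums_unique2[symmetric])
  qed
  have A'_eq: "A' s = (2 * (x - s * y) * (y - s * x) / (1 - s\<^sup>2)\<^sup>2 + s / (1 - s\<^sup>2)) * A s"
    if s: "norm s < 1" for s
  proof -
    have pos: "1 - s\<^sup>2 > 0"
      using s by (simp add: abs_square_less_1)
    \<comment> \<open>The two instances of \<open>rec1\<close> form a linear system for
      \<open>B x y s\<close> and \<open>B y x s\<close> with determinant
      \<open>1 - s\<^sup>2\<close>.\<close>
    have "B x y s * (1 - s\<^sup>2) = 2 * (x - s * y) * A s"
    proof -
      have "p * (1 - s\<^sup>2) = 2 * (x - s * y) * a"
        if "p = 2 * x * a - s * q" "q = 2 * y * a - s * p" for a p q
        using that(1) unfolding that(2) by (simp add: power2_eq_square algebra_simps)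
      then show ?thesis
        using rec1[OF s, of x y] rec1[OF s, of y x] by blast
    qed
    then have Bxy: "B x y s = 2 * (x - s * y) * A s / (1 - s\<^sup>2)"
      using pos by (simp add: field_simps)
    have "A' s * (1 - s\<^sup>2) = (y - s * x) * B x y s + s * A s"
    proof -
      have "a' * (1 - s\<^sup>2) = (y - s * x) * p + s * a"
        if "2 * a' = 2 * y * p - 2 * x * (s * p) + 2 * (s * (a + s * a'))" for a a' p
        using that by (simp add: power2_eq_square algebra_simps)
      then show ?thesis
        using rec2[OF s] by blast
    qed
    then have "A' s = ((y - s * x) * B x y s + s * A s) / (1 - s\<^sup>2)"
      using pos by (simp add: field_simps)
    also have "\<dots> = (2 * (x - s * y) * (y - s * x) / (1 - s\<^sup>2)\<^sup>2 + s / (1 - s\<^sup>2)) * A s"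
      unfolding Bxy using pos by (simp add: power2_eq_square add_divide_distrib algebra_simps)
    finally show ?thesis .
  qed
  have M_pos: "mehler_kernel x y s > 0" if "\<bar>s\<bar> < 1" for s
    using that by (simp add: mehler_kernel_def abs_square_less_1)
  have "A r / mehler_kernel x y r = A 0 / mehler_kernel x y 0"
  proof (rule DERIV_isconst3[of "- 1" 1 r 0 "\<lambda>s. A s / mehler_kernel x y s"])
    fix s :: real
    assume "s \<in> {-1<..<1}"
    then have s: "norm s < 1" "\<bar>s\<bar> < 1"
      by auto
    have "(A has_real_derivative A' s) (at s)"
      unfolding A_def A'_def by (rule termdiffs_strong'[OF summable s(1)])
    from DERIV_divide[OF this DERIV_mehler_kernel[OF s(2), of x y]] M_pos[OF s(2)]
    show "((\<lambda>s. A s / mehler_kernel x y s) has_real_derivative 0) (at s)"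
      unfolding A'_eq[OF s(1)] by (simp add: mult_ac)
  qed (use r in auto)
  moreover have "A 0 = 1"
    using powser_zero[of "mehler_coeff x y"] by (simp add: A_def mehler_coeff_def[of _ _ 0])
  moreover have "mehler_kernel x y 0 = 1"
    by (simp add: mehler_kernel_def)
  ultimately have "A r = mehler_kernel x y r"
    using M_pos[OF r] by (simp add: field_simps)
  then show ?thesis
    using A[of r] r by simp
qed

subsection \<open>Laplace and Gaussian integrals\<close>

lemma has_bochner_integral_exp_cos:
  fixes c z :: real
  assumes c: "c > 0"
  shows "has_bochner_integral lborel (\<lambda>t. indicator {0<..} t * (exp (- (t * c)) * cos (t * z)))
    (c / (c\<^sup>2 + z\<^sup>2))"
proof -
  have pos: "c\<^sup>2 + z\<^sup>2 > 0"
    using c by (simp add: add_pos_nonneg)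
  have int: "set_integrable lborel {0<..} (\<lambda>t. exp (- (t * c)) * cos (t * z))"
    by (rule set_integrable_bound[OF integrable_I0i_exp_mscale[OF c]])
       (auto simp: set_borel_measurable_def abs_mult mult_left_le)
  \<comment> \<open>The real part of
    \<open>- exp (- (c - \<i> * z) * t) / (c - \<i> * z)\<close>.\<close>
  define F where "F = (\<lambda>t. exp (- (t * c)) * (z * sin (t * z) - c * cos (t * z)) / (c\<^sup>2 + z\<^sup>2))"
  have "(LBINT t=0..\<infinity>. exp (- (t * c)) * cos (t * z)) = 0 - (- (c / (c\<^sup>2 + z\<^sup>2)))"
  proof (rule interval_integral_FTC_integrable[where F = F])
    fix t :: real
    have "(F has_real_derivative
        (- c * exp (- (t * c)) * (z * sin (t * z) - c * cos (t * z))
          + exp (- (t * c)) * (z * (cos (t * z) * z) + c * (sin (t * z) * z))) / (c\<^sup>2 + z\<^sup>2)) (at t)"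
      unfolding F_def using c by (auto intro!: derivative_eq_intros simp: add_nonneg_eq_0_iff)
    also have "(- c * exp (- (t * c)) * (z * sin (t * z) - c * cos (t * z))
          + exp (- (t * c)) * (z * (cos (t * z) * z) + c * (sin (t * z) * z))) / (c\<^sup>2 + z\<^sup>2)
        = exp (- (t * c)) * cos (t * z) * (c\<^sup>2 + z\<^sup>2) / (c\<^sup>2 + z\<^sup>2)"
      by (simp add: algebra_simps power2_eq_square)
    also have "\<dots> = exp (- (t * c)) * cos (t * z)"
      using c by simp
    finally show "(F has_vector_derivative exp (- (t * c)) * cos (t * z)) (at t)"
      by (simp add: has_real_derivative_iff_has_vector_derivative)
    show "isCont (\<lambda>t. exp (- (t * c)) * cos (t * z)) t"
      by (intro continuous_intros)
  next
    show "set_integrable lborel (einterval 0 \<infinity>) (\<lambda>t. exp (- (t * c)) * cos (t * z))"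
      using int by (simp add: einterval_def greaterThan_def)
    have "(F \<longlongrightarrow> F 0) (at_right 0)"
      unfolding F_def using pos by (intro tendsto_intros) auto
    then show "((F \<circ> real_of_ereal) \<longlongrightarrow> - (c / (c\<^sup>2 + z\<^sup>2))) (at_right 0)"
      unfolding zero_ereal_def ereal_tendsto_simps by (simp add: F_def)
    have "(F \<longlongrightarrow> 0) at_top"
    proof (rule tendsto_0_le[where K = "(\<bar>z\<bar> + \<bar>c\<bar>) / (c\<^sup>2 + z\<^sup>2)"])
      have "filterlim (\<lambda>t. t * c) at_top at_top"
        using c by (intro filterlim_at_top_mult_tendsto_pos[OF tendsto_const _ filterlim_ident]) auto
      then show "((\<lambda>t. exp (- (t * c))) \<longlongrightarrow> 0) at_top"
        by (intro filterlim_compose[OF exp_at_bot] filterlim_compose[OF filterlim_uminus_at_bot_at_top])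
      show "\<forall>\<^sub>F t in at_top. norm (F t) \<le> norm (exp (- (t * c))) * ((\<bar>z\<bar> + \<bar>c\<bar>) / (c\<^sup>2 + z\<^sup>2))"
      proof (rule always_eventually, rule allI)
        fix t
        have "\<bar>z * sin (t * z)\<bar> \<le> \<bar>z\<bar> * 1" "\<bar>c * cos (t * z)\<bar> \<le> \<bar>c\<bar> * 1"
          unfolding abs_mult by (intro mult_left_mono; simp)+
        then have "\<bar>z * sin (t * z) - c * cos (t * z)\<bar> \<le> \<bar>z\<bar> + \<bar>c\<bar>"
          by linarith
        then show "norm (F t) \<le> norm (exp (- (t * c))) * ((\<bar>z\<bar> + \<bar>c\<bar>) / (c\<^sup>2 + z\<^sup>2))"
          using pos by (simp add: F_def abs_mult divide_right_mono mult_left_mono)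
      qed
    qed
    then show "((F \<circ> real_of_ereal) \<longlongrightarrow> 0) (at_left \<infinity>)"
      unfolding ereal_tendsto_simps .
  qed simp
  then have "(LINT t|lborel. indicator {0<..} t *\<^sub>R (exp (- (t * c)) * cos (t * z))) = c / (c\<^sup>2 + z\<^sup>2)"
    by (simp add: interval_lebesgue_integral_0_infty set_lebesgue_integral_def)
  with int show ?thesis
    by (simp add: has_bochner_integral_iff set_integrable_def)
qed

lemma has_bochner_integral_exp_Ioi:
  fixes c :: real
  assumes "c > 0"
  shows "has_bochner_integral lborel (\<lambda>t. indicator {0<..} t * exp (- (t * c))) (1 / c)"
  using has_bochner_integral_exp_cos[OF assms, of 0] assms by (simp add: power2_eq_square)

lemma integrable_gaussian: "integrable lborel (\<lambda>w :: real. exp (- w\<^sup>2))"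
proof -
  have "integrable lborel (\<lambda>w. sqrt pi * normal_density 0 (1 / sqrt 2) w)"
    by simp
  then show ?thesis
    by (simp add: normal_density_def power_divide)
qed

text \<open>The characteristic function of the standard normal law, with both variables rescaled by
  \<open>sqrt 2\<close>.\<close>

lemma integral_gaussian_cos:
  "(LINT w|lborel. exp (- w\<^sup>2) * cos (c * w)) = sqrt pi * exp (- c\<^sup>2 / 4)" for c :: real
proof -
  define t where "t = c / sqrt 2"
  have "complex_of_real (exp (- t\<^sup>2 / 2)) = (CLINT x|std_normal_distribution. iexp (t * x))"
    using char_std_normal_distribution by (simp add: char_def fun_eq_iff)
  also have "\<dots> = (CLINT x|lborel. std_normal_density x *\<^sub>R iexp (t * x))"
    by (subst integral_density) auto
  finally have eq: "complex_of_real (exp (- t\<^sup>2 / 2)) = (CLINT x|lborel. std_normal_density x *\<^sub>R iexp (t * x))" .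
  have int: "complex_integrable lborel (\<lambda>x. std_normal_density x *\<^sub>R iexp (t * x))"
  proof (rule Bochner_Integration.integrable_bound)
    show "integrable lborel std_normal_density"
      by simp
  qed auto
  have "exp (- t\<^sup>2 / 2) = Re (complex_of_real (exp (- t\<^sup>2 / 2)))"
    by simp
  also have "\<dots> = (LINT x|lborel. Re (std_normal_density x *\<^sub>R iexp (t * x)))"
    unfolding eq by (rule integral_Re[OF int, symmetric])
  also have "\<dots> = (LINT x|lborel. std_normal_density x * cos (t * x))"
    by (simp add: Re_exp)
  also have "\<dots> = \<bar>sqrt 2\<bar> *\<^sub>R (LINT w|lborel. std_normal_density (0 + sqrt 2 * w) * cos (t * (0 + sqrt 2 * w)))"
    by (rule lborel_integral_real_affine) simp
  also have "(LINT w|lborel. std_normal_density (0 + sqrt 2 * w) * cos (t * (0 + sqrt 2 * w)))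
      = (LINT w|lborel. 1 / sqrt (2 * pi) * (exp (- w\<^sup>2) * cos (c * w)))"
    by (intro Bochner_Integration.integral_cong)
       (auto simp: std_normal_density_def power_mult_distrib t_def)
  finally have "exp (- t\<^sup>2 / 2) = sqrt 2 * (1 / sqrt (2 * pi) * (LINT w|lborel. exp (- w\<^sup>2) * cos (c * w)))"
    by simp
  moreover have "t\<^sup>2 / 2 = c\<^sup>2 / 4"
    by (simp add: t_def power_divide)
  ultimately show ?thesis
    by (simp add: real_sqrt_mult field_simps)
qed

lemma has_bochner_integral_lorentz:
  fixes L :: real
  assumes L: "L > 0"
  shows "has_bochner_integral lborel (\<lambda>w. 1 / (w\<^sup>2 + L\<^sup>2)) (pi / L)"
proof -
  define F where "F = (\<lambda>w. arctan (w / L) / L)"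
  have pos: "w\<^sup>2 + L\<^sup>2 > 0" for w
    using L by (simp add: add_nonneg_pos)
  have F: "(F has_real_derivative 1 / (w\<^sup>2 + L\<^sup>2)) (at w)" for w
  proof -
    have "(F has_real_derivative inverse (1 + (w / L)\<^sup>2) * (1 / L) / L) (at w)"
      unfolding F_def using L by (auto intro!: derivative_eq_intros)
    also have "inverse (1 + (w / L)\<^sup>2) * (1 / L) / L = 1 / (w\<^sup>2 + L\<^sup>2)"
    proof -
      have "(1 + (w / L)\<^sup>2) * L\<^sup>2 = w\<^sup>2 + L\<^sup>2"
        using L by (simp add: power_divide distrib_right)
      then show ?thesis
        by (simp add: divide_inverse power2_eq_square mult.assoc flip: inverse_mult_distrib)
    qed
    finally show ?thesis .
  qed
  have top: "filterlim (\<lambda>w. w / L) at_top at_top" and bot: "filterlim (\<lambda>w. w / L) at_bot at_bot"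
    using L by real_asymp+
  have "(F \<longlongrightarrow> pi / 2 / L) at_top" "(F \<longlongrightarrow> - (pi / 2) / L) at_bot"
    unfolding F_def using L
    by (intro tendsto_divide tendsto_const filterlim_compose[OF tendsto_arctan_at_top top]
          filterlim_compose[OF tendsto_arctan_at_bot bot]; simp)+
  then have lim: "((F \<circ> real_of_ereal) \<longlongrightarrow> pi / 2 / L) (at_left \<infinity>)"
    "((F \<circ> real_of_ereal) \<longlongrightarrow> - (pi / 2) / L) (at_right (- \<infinity>))"
    unfolding ereal_tendsto_simps by auto
  have cont: "isCont (\<lambda>w. 1 / (w\<^sup>2 + L\<^sup>2)) w" for w
    using pos[of w] by (intro continuous_intros) auto
  have nonneg: "AE w in lborel. - \<infinity> < ereal w \<longrightarrow> ereal w < \<infinity> \<longrightarrow> 0 \<le> 1 / (w\<^sup>2 + L\<^sup>2)"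
    by simp
  have "set_integrable lborel (einterval (- \<infinity>) \<infinity>) (\<lambda>w. 1 / (w\<^sup>2 + L\<^sup>2))"
    by (rule interval_integral_FTC_nonneg(1)[OF _ F cont nonneg lim(2) lim(1)]) simp
  moreover have "(LBINT w=-\<infinity>..\<infinity>. 1 / (w\<^sup>2 + L\<^sup>2)) = pi / 2 / L - (- (pi / 2) / L)"
    by (rule interval_integral_FTC_nonneg(2)[OF _ F cont nonneg lim(2) lim(1)]) simp
  ultimately show ?thesis
    by (simp add: has_bochner_integral_iff set_integrable_def interval_lebesgue_integral_def
      set_lebesgue_integral_def einterval_iff einterval_def)
qed

subsection \<open>Hyperbolic substitution\<close>

lemma borel_measurable_sinh [measurable (raw)]:
  fixes f :: "'a \<Rightarrow> real"
  assumes "f \<in> borel_measurable M"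
  shows "(\<lambda>x. sinh (f x)) \<in> borel_measurable M"
  by (rule measurable_compose[OF assms borel_measurable_continuous_onI]) (intro continuous_intros)

lemma borel_measurable_cosh [measurable (raw)]:
  fixes f :: "'a \<Rightarrow> real"
  assumes "f \<in> borel_measurable M"
  shows "(\<lambda>x. cosh (f x)) \<in> borel_measurable M"
  by (rule measurable_compose[OF assms borel_measurable_continuous_onI]) (intro continuous_intros)

lemma borel_measurable_tanh [measurable (raw)]:
  fixes f :: "'a \<Rightarrow> real"
  assumes "f \<in> borel_measurable M"
  shows "(\<lambda>x. tanh (f x)) \<in> borel_measurable M"
  unfolding tanh_def using assms by measurable

lemma cosh_sinh_ge:
  fixes A B u :: real
  shows "A * cosh u - B * sinh u \<ge> (A - \<bar>B\<bar>) * cosh u"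
proof -
  have "\<bar>B * sinh u\<bar> \<le> \<bar>B\<bar> * cosh u"
    unfolding abs_mult using sinh_less_cosh_real[of "\<bar>u\<bar>"]
    by (intro mult_left_mono) (auto simp: abs_if)
  then show ?thesis
    by (simp add: algebra_simps)
qed

lemma cosh_sinh_pos:
  fixes A B u :: real
  assumes "\<bar>B\<bar> < A"
  shows "A * cosh u - B * sinh u > 0"
proof -
  have "0 < (A - \<bar>B\<bar>) * cosh u"
    using assms by simp
  with cosh_sinh_ge[where A = A and B = B and u = u] show ?thesis
    by linarith
qed

text \<open>For \<open>\<bar>B\<bar> < A\<close> the map
  \<open>u \<mapsto> A * sinh u - B * cosh u\<close> is an increasing bijection of the line whose
  derivative is the second factor. The equivalence is used in both directions: from \<open>u\<close>
  to \<open>w\<close> for the product formula, and from \<open>w\<close> to \<open>u\<close> for the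
  Lorentz integrals.\<close>

lemma has_bochner_integral_hyperbolic_subst:
  fixes f :: "real \<Rightarrow> real"
  assumes AB: "\<bar>B\<bar> < A" and f [measurable]: "f \<in> borel_measurable borel"
  shows "has_bochner_integral lborel
      (\<lambda>u. f (A * sinh u - B * cosh u) * (A * cosh u - B * sinh u)) I
    \<longleftrightarrow> has_bochner_integral lborel f I"
proof -
  define g where "g = (\<lambda>u. A * sinh u - B * cosh u)"
  define g' where "g' = (\<lambda>u. A * cosh u - B * sinh u)"
  have pos: "g' u > 0" for u
    unfolding g'_def by (rule cosh_sinh_pos[OF AB])
  have der: "(g has_real_derivative g' u) (at u)" for u
    unfolding g_def g'_def by (auto intro!: derivative_eq_intros)
  have cont: "continuous_on UNIV g"
    unfolding g_def by (intro continuous_intros)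
  have inj: "inj g"
  proof (rule strict_mono_imp_inj_on)
    show "strict_mono g"
      using pos der DERIV_pos_imp_increasing by (metis strict_monoI)
  qed
  have lims: "filterlim g at_top at_top" "filterlim g at_bot at_bot"
  proof -
    have e: "g u = (A - B) / 2 * exp u - (A + B) / 2 * exp (- u)" for u
      by (simp add: g_def sinh_field_def cosh_field_def field_simps)
    show "filterlim g at_top at_top" "filterlim g at_bot at_bot"
      unfolding e using AB by real_asymp+
  qed
  have surj: "range g = UNIV"
  proof -
    have "y \<in> range g" for y
    proof -
      obtain a where a: "g a \<le> y"
        using lims(2) unfolding filterlim_at_bot eventually_at_bot_linorder by blast
      obtain b where b: "g b \<ge> y"
        using lims(1) unfolding filterlim_at_top eventually_at_top_linorder by blast
      have "connected (range g)"
        by (intro connected_continuous_image cont) auto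
      then show ?thesis
        using a b by (metis connected_iff_interval rangeI)
    qed
    then show ?thesis by auto
  qed
  have meas [measurable]: "(\<lambda>u. \<bar>g' u\<bar> * f (g u)) \<in> borel_measurable borel"
    unfolding g_def g'_def by measurable
  \<comment> \<open>The change of variables theorem speaks of absolute integrability for Lebesgue
    measure; on Borel functions this agrees with \<open>lborel\<close>.\<close>
  have lebesgue: "has_bochner_integral lborel h I
      \<longleftrightarrow> h absolutely_integrable_on UNIV \<and> integral UNIV h = I"
    if [measurable]: "h \<in> borel_measurable borel" for h :: "real \<Rightarrow> real"
  proof -
    have "integrable lebesgue h \<longleftrightarrow> integrable lborel h"
      by (rule integrable_completion) simp
    moreover have "integral\<^sup>L lborel h = integral UNIV h" if "integrable lborel h"
      using integral_lborel[OF that] by simp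
    ultimately show ?thesis
      by (auto simp: has_bochner_integral_iff set_integrable_def)
  qed
  have "(\<lambda>u. f (A * sinh u - B * cosh u) * (A * cosh u - B * sinh u)) = (\<lambda>u. \<bar>g' u\<bar> * f (g u))"
    using pos by (auto simp: fun_eq_iff g_def g'_def mult.commute abs_of_pos)
  moreover have "has_bochner_integral lborel (\<lambda>u. \<bar>g' u\<bar> * f (g u)) I \<longleftrightarrow> has_bochner_integral lborel f I"
    unfolding lebesgue[OF meas] lebesgue[OF f]
    using has_absolute_integral_change_of_variables_1'[of UNIV g g' f I] der inj surj by simp
  ultimately show ?thesis by simp
qed

lemma integrable_inverse_cosh: "integrable lborel (\<lambda>u :: real. 1 / cosh u)"
proof -
  have "has_bochner_integral lborel (\<lambda>u. 1 / ((1 * sinh u - 0 * cosh u)\<^sup>2 + 1\<^sup>2) * (1 * cosh u - 0 * sinh u)) (pi / 1)"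
    by (subst has_bochner_integral_hyperbolic_subst) (use has_bochner_integral_lorentz[of 1] in auto)
  then have "integrable lborel (\<lambda>u :: real. 1 / ((1 * sinh u - 0 * cosh u)\<^sup>2 + 1\<^sup>2) * (1 * cosh u - 0 * sinh u))"
    by (rule integrable.intros)
  also have "(\<lambda>u :: real. 1 / ((1 * sinh u - 0 * cosh u)\<^sup>2 + 1\<^sup>2) * (1 * cosh u - 0 * sinh u)) = (\<lambda>u. 1 / cosh u)"
    by (simp add: fun_eq_iff cosh_square_eq[symmetric]) (simp add: power2_eq_square)
  finally show ?thesis .
qed

subsection \<open>The product of Hermite functions as an integral\<close>

definition product_weight :: "real \<Rightarrow> real \<Rightarrow> real \<Rightarrow> real" where
  "product_weight a b u = exp (- (b * sinh u - a * cosh u)\<^sup>2) / cosh u"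

lemma borel_measurable_product_weight [measurable (raw)]:
  assumes [measurable]: "f \<in> borel_measurable M"
  shows "(\<lambda>x. product_weight a b (f x)) \<in> borel_measurable M"
  unfolding product_weight_def by measurable

lemma product_weight_nonneg [simp]: "product_weight a b u \<ge> 0"
  by (simp add: product_weight_def)

lemma product_weight_le: "product_weight a b u \<le> 1 / cosh u"
  by (simp add: product_weight_def divide_right_mono)

lemma abs_tanh_less_1: "\<bar>tanh u\<bar> < 1" for u :: real
  using tanh_real_lt_1[of u] tanh_real_gt_neg1[of u] by linarith

lemma integrable_tanh_power_product_weight:
  "integrable lborel (\<lambda>u. tanh u ^ n * product_weight a b u)"
proof (rule Bochner_Integration.integrable_bound[OF integrable_inverse_cosh])
  show "AE u in lborel. norm (tanh u ^ n * product_weight a b u) \<le> norm (1 / cosh u)"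
  proof (rule AE_I2)
    fix u :: real
    have "\<bar>tanh u\<bar> ^ n * product_weight a b u \<le> 1 * (1 / cosh u)"
      using abs_tanh_less_1[of u] product_weight_le[of a b u]
      by (intro mult_mono power_le_one) auto
    then show "norm (tanh u ^ n * product_weight a b u) \<le> norm (1 / cosh u)"
      by (simp add: abs_mult power_abs)
  qed
qed measurable

text \<open>The substitution \<open>w = b * sinh u - a * cosh u\<close>, followed by averaging over \<open>w\<close> and \<open>- w\<close>.\<close>

lemma product_weight_generating_integral:
  fixes a b z :: real
  assumes ab: "\<bar>a\<bar> < b" and z: "\<bar>z\<bar> < 1"
  defines "p \<equiv> b - z * a"
  shows "(LINT u|lborel. product_weight a b u / (1 - z * tanh u))
      = (LINT w|lborel. exp (- w\<^sup>2) * p / ((1 - z\<^sup>2) * w\<^sup>2 + p\<^sup>2))"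
proof -
  \<comment> \<open>With \<open>w = b * sinh u - a * cosh u\<close> the derivative
    \<open>b * cosh u - a * sinh u\<close> equals \<open>s w\<close>, and \<open>p\<close>,
    \<open>q\<close> solve \<open>p * s w + q * w = c * (cosh u - z * sinh u)\<close>. This makes
    \<open>f\<close> the integrand in the variable \<open>w\<close>.\<close>
  define q where "q = a - z * b"
  define c where "c = b\<^sup>2 - a\<^sup>2"
  define s where "s = (\<lambda>w. sqrt (w\<^sup>2 + c))"
  define f where "f = (\<lambda>w. c * exp (- w\<^sup>2) / (s w * (p * s w + q * w)))"
  have c: "c > 0"
    using ab power_strict_mono[of "\<bar>a\<bar>" b 2] by (simp add: c_def)
  have z2: "1 - z\<^sup>2 > 0"
    using z by (simp add: abs_square_less_1)
  have p: "p > 0"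
  proof -
    have "\<bar>z * a\<bar> \<le> 1 * \<bar>a\<bar>"
      unfolding abs_mult using z by (intro mult_right_mono) auto
    then show ?thesis
      using ab by (simp add: p_def abs_le_iff)
  qed
  have pq: "p\<^sup>2 - q\<^sup>2 = (1 - z\<^sup>2) * c"
    by (simp add: p_def q_def c_def power2_eq_square algebra_simps)
  have qp: "\<bar>q\<bar> < p"
  proof -
    have "q\<^sup>2 < p\<^sup>2"
      using pq z2 c by (smt (verit) mult_pos_pos)
    then show ?thesis
      using p power2_less_imp_less[of "\<bar>q\<bar>" p] by simp
  qed
  have s: "s w > \<bar>w\<bar>" "s w > 0" "(s w)\<^sup>2 = w\<^sup>2 + c" for w
  proof -
    have "sqrt (w\<^sup>2) < sqrt (w\<^sup>2 + c)"
      using c by (intro real_sqrt_less_mono) simp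
    then show "s w > \<bar>w\<bar>"
      by (simp add: s_def)
    then show "s w > 0"
      by linarith
    show "(s w)\<^sup>2 = w\<^sup>2 + c"
      using c by (simp add: s_def add_nonneg_pos less_imp_le)
  qed
  have den: "p * s w + q * w > 0" for w
  proof -
    have "\<bar>q * w\<bar> \<le> p * \<bar>w\<bar>"
      unfolding abs_mult using qp by (intro mult_right_mono) auto
    also have "\<dots> < p * s w"
      using p s(1) by simp
    finally show ?thesis by linarith
  qed
  have meas [measurable]: "f \<in> borel_measurable borel"
    unfolding f_def s_def by measurable
  have subst: "f (b * sinh u - a * cosh u) * (b * cosh u - a * sinh u)
      = product_weight a b u / (1 - z * tanh u)" for u
  proof -
    define w w' where "w = b * sinh u - a * cosh u" and "w' = b * cosh u - a * sinh u"
    have cs: "cosh u * cosh u = 1 + sinh u * sinh u"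
      using cosh_square_eq[of u] by (simp add: power2_eq_square)
    have w': "w' > 0"
      unfolding w'_def by (rule cosh_sinh_pos[OF ab])
    have "w'\<^sup>2 = w\<^sup>2 + c"
      by (simp add: w_def w'_def c_def power2_eq_square algebra_simps cs)
    then have sw: "s w = w'"
      using w' by (simp add: s_def real_sqrt_unique)
    have dd: "p * w' + q * w = c * (cosh u - z * sinh u)"
      by (simp add: p_def q_def w_def w'_def c_def power2_eq_square algebra_simps)
    have "\<bar>z * sinh u\<bar> < cosh u"
      using cosh_sinh_pos[of z 1 u] cosh_sinh_pos[of "- z" 1 u] z by (simp add: abs_less_iff)
    then have d0: "cosh u - z * sinh u > 0"
      by linarith
    have "f w * w' = exp (- w\<^sup>2) / (cosh u - z * sinh u)"
      unfolding f_def sw dd using c w' by simp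
    also have "\<dots> = product_weight a b u / (1 - z * tanh u)"
      using d0 by (simp add: product_weight_def tanh_def w_def divide_simps)
    finally show ?thesis
      by (simp add: w_def w'_def)
  qed
  have meas' [measurable]: "(\<lambda>u. product_weight a b u / (1 - z * tanh u)) \<in> borel_measurable borel"
    by measurable
  have "integrable lborel (\<lambda>u. product_weight a b u / (1 - z * tanh u))"
  proof (rule Bochner_Integration.integrable_bound)
    show "integrable lborel (\<lambda>u :: real. 1 / (1 - \<bar>z\<bar>) * (1 / cosh u))"
      by (intro integrable_mult_right integrable_inverse_cosh)
    show "AE u in lborel. norm (product_weight a b u / (1 - z * tanh u))
        \<le> norm (1 / (1 - \<bar>z\<bar>) * (1 / cosh u))"
    proof (rule AE_I2)
      fix u
      have "\<bar>z * tanh u\<bar> \<le> \<bar>z\<bar> * 1"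
        unfolding abs_mult using abs_tanh_less_1[of u] by (intro mult_left_mono) auto
      then have "1 - z * tanh u \<ge> 1 - \<bar>z\<bar>"
        by linarith
      then have "product_weight a b u / (1 - z * tanh u) \<le> (1 / cosh u) / (1 - \<bar>z\<bar>)"
        using z product_weight_le[of a b u] by (intro frac_le) auto
      with \<open>1 - z * tanh u \<ge> 1 - \<bar>z\<bar>\<close>
      show "norm (product_weight a b u / (1 - z * tanh u)) \<le> norm (1 / (1 - \<bar>z\<bar>) * (1 / cosh u))"
        using z by (simp add: abs_of_nonneg mult.commute)
    qed
  qed simp
  then have "has_bochner_integral lborel (\<lambda>u. f (b * sinh u - a * cosh u) * (b * cosh u - a * sinh u))
      (LINT u|lborel. product_weight a b u / (1 - z * tanh u))"
    unfolding subst by (rule has_bochner_integral_integrable)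
  then have f: "has_bochner_integral lborel f (LINT u|lborel. product_weight a b u / (1 - z * tanh u))"
    by (subst (asm) has_bochner_integral_hyperbolic_subst[OF ab meas])
  have f': "has_bochner_integral lborel (\<lambda>w. f (- w)) (LINT u|lborel. product_weight a b u / (1 - z * tanh u))"
    using f lborel_has_bochner_integral_real_affine_iff[of "- 1" f _ 0] by simp
  have "has_bochner_integral lborel (\<lambda>w. (f w + f (- w)) / 2)
      (((LINT u|lborel. product_weight a b u / (1 - z * tanh u))
        + (LINT u|lborel. product_weight a b u / (1 - z * tanh u))) / 2)"
    by (rule has_bochner_integral_divide_zero[OF has_bochner_integral_add[OF f f']])
  moreover have "(f w + f (- w)) / 2 = exp (- w\<^sup>2) * p / ((1 - z\<^sup>2) * w\<^sup>2 + p\<^sup>2)" for w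
  proof -
    have "(p * s w + q * w) * (p * s w - q * w) = p\<^sup>2 * (s w)\<^sup>2 - q\<^sup>2 * w\<^sup>2"
      by (simp add: power2_eq_square algebra_simps)
    also have "\<dots> = (p\<^sup>2 - q\<^sup>2) * w\<^sup>2 + p\<^sup>2 * c"
      by (simp add: s(3) algebra_simps)
    also have "\<dots> = c * ((1 - z\<^sup>2) * w\<^sup>2 + p\<^sup>2)"
      unfolding pq by (simp add: algebra_simps)
    finally have prod: "(p * s w + q * w) * (p * s w - q * w) = c * ((1 - z\<^sup>2) * w\<^sup>2 + p\<^sup>2)" .
    have even: "s (- w) = s w"
      by (simp add: s_def)
    have d1: "p * s w + q * w > 0" "p * s w - q * w > 0"
      using den[of w] den[of "- w"] by (auto simp: even)
    \<comment> \<open>Averaging removes the square root: the denominators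
      \<open>p * s w + q * w\<close> and \<open>p * s w - q * w\<close> add up to
      \<open>2 * (p * s w)\<close>, which cancels the common factor \<open>s w\<close>.\<close>
    have "x / (y * d) + x / (y * e) = 2 * (x * P / (d * e))"
      if "y > 0" "d > 0" "e > 0" "d + e = 2 * (P * y)" for x y d e P :: real
    proof -
      have "x / (y * d) + x / (y * e) = x * (d + e) / (y * (d * e))"
        using that(1-3) by (simp add: field_simps)
      then show ?thesis
        using that by simp
    qed
    from this[of "s w" "p * s w + q * w" "p * s w - q * w" p "c * exp (- w\<^sup>2)"] d1 s(2)[of w]
    have e: "f w + f (- w) = 2 * (c * exp (- w\<^sup>2) * p / (c * ((1 - z\<^sup>2) * w\<^sup>2 + p\<^sup>2)))"
      unfolding prod by (simp add: f_def even)
    have "(f w + f (- w)) / 2 = c * exp (- w\<^sup>2) * p / (c * ((1 - z\<^sup>2) * w\<^sup>2 + p\<^sup>2))"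
      unfolding e by (rule nonzero_mult_div_cancel_left) simp
    also have "\<dots> = exp (- w\<^sup>2) * p / ((1 - z\<^sup>2) * w\<^sup>2 + p\<^sup>2)"
      using c by simp
    finally show ?thesis .
  qed
  ultimately have "has_bochner_integral lborel (\<lambda>w. exp (- w\<^sup>2) * p / ((1 - z\<^sup>2) * w\<^sup>2 + p\<^sup>2))
      (LINT u|lborel. product_weight a b u / (1 - z * tanh u))"
    by simp
  then show ?thesis
    by (simp add: has_bochner_integral_iff)
qed

lemma integrable_lborel_pair_mult:
  fixes f g :: "real \<Rightarrow> real"
  assumes f: "integrable lborel f" and g: "integrable lborel g"
  shows "integrable (lborel \<Otimes>\<^sub>M lborel) (\<lambda>(x, y). f x * g y)"
proof (rule lborel_pair.Fubini_integrable)
  have [measurable]: "f \<in> borel_measurable borel" "g \<in> borel_measurable borel"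
    using f g borel_measurable_integrable by force+
  show "(\<lambda>(x, y). f x * g y) \<in> borel_measurable (lborel \<Otimes>\<^sub>M lborel)"
    by measurable
  have "integrable lborel (\<lambda>x. \<bar>f x\<bar> * (LINT y|lborel. \<bar>g y\<bar>))"
    using f by (intro integrable_mult_left integrable_abs)
  then show "integrable lborel (\<lambda>x. LINT y|lborel. norm (case (x, y) of (x, y) \<Rightarrow> f x * g y))"
    by (simp add: abs_mult)
  show "AE x in lborel. integrable lborel (\<lambda>y. case (x, y) of (x, y) \<Rightarrow> f x * g y)"
    using g by simp
qed

text \<open>The Lorentz kernel \<open>p / (d\<^sup>2 * w\<^sup>2 + p\<^sup>2)\<close> is twice the
  integral of \<open>exp (- 2 * p * t) * cos (2 * d * w * t)\<close> over t > 0. After Fubini the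
  \<open>w\<close>-integral is the Fourier transform of a Gaussian, and the 2 in the frequency turns
  it into \<open>sqrt pi * exp (- d\<^sup>2 * t\<^sup>2)\<close>.\<close>

lemma lorentz_gauss_integral:
  fixes p d :: real
  assumes p: "p > 0"
  shows "(LINT w|lborel. exp (- w\<^sup>2) * p / (d\<^sup>2 * w\<^sup>2 + p\<^sup>2))
    = 2 * sqrt pi * (LINT t|lborel. indicator {0<..} t * exp (- (d\<^sup>2 * t\<^sup>2) - 2 * t * p))"
proof -
  define h where "h = (\<lambda>w t :: real. exp (- w\<^sup>2) * (indicator {0<..} t * exp (- (t * (2 * p)))) * cos (2 * d * w * t))"
  have int: "integrable (lborel \<Otimes>\<^sub>M lborel) (case_prod h)"
  proof (rule Bochner_Integration.integrable_bound)
    show "integrable (lborel \<Otimes>\<^sub>M lborel)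
        (\<lambda>(w, t). exp (- w\<^sup>2) * (indicator {0<..} t * exp (- (t * (2 * p)))) :: real)"
      using p integrable.intros[OF has_bochner_integral_exp_Ioi[of "2 * p"]]
      by (intro integrable_lborel_pair_mult integrable_gaussian) auto
    show "case_prod h \<in> borel_measurable (lborel \<Otimes>\<^sub>M lborel)"
      unfolding h_def by measurable
    show "AE x in lborel \<Otimes>\<^sub>M lborel. norm (case_prod h x)
        \<le> norm (case x of (w, t) \<Rightarrow> (exp (- w\<^sup>2) * (indicator {0<..} t * exp (- (t * (2 * p)))) :: real))"
      by (intro AE_I2) (auto simp: h_def abs_mult mult_left_le)
  qed
  have inner1: "(LINT t|lborel. h w t) = exp (- w\<^sup>2) * p / (d\<^sup>2 * w\<^sup>2 + p\<^sup>2) / 2" for w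
  proof -
    have "has_bochner_integral lborel (\<lambda>t. indicator {0<..} t * (exp (- (t * (2 * p))) * cos (t * (2 * d * w))))
        (2 * p / ((2 * p)\<^sup>2 + (2 * d * w)\<^sup>2))"
      using p by (intro has_bochner_integral_exp_cos) simp
    from has_bochner_integral_mult_right[OF this, of "exp (- w\<^sup>2)"]
    have "(LINT t|lborel. h w t) = exp (- w\<^sup>2) * (2 * p / ((2 * p)\<^sup>2 + (2 * d * w)\<^sup>2))"
      unfolding h_def by (intro has_bochner_integral_integral_eq) (simp add: mult_ac)
    also have "(2 * p)\<^sup>2 + (2 * d * w)\<^sup>2 = 2 * (2 * (d\<^sup>2 * w\<^sup>2 + p\<^sup>2))"
      by (simp add: power_mult_distrib)
    finally have e: "(LINT t|lborel. h w t) = exp (- w\<^sup>2) * (2 * p / (2 * (2 * (d\<^sup>2 * w\<^sup>2 + p\<^sup>2))))" .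
    have "x * (2 * p / (2 * (2 * y))) = x * p / y / 2" for x y :: real
      by simp
    then show ?thesis
      unfolding e .
  qed
  have inner2: "(LINT w|lborel. h w t)
      = sqrt pi * (indicator {0<..} t * exp (- (d\<^sup>2 * t\<^sup>2) - 2 * t * p))" for t
  proof -
    have "(LINT w|lborel. h w t)
        = (LINT w|lborel. (indicator {0<..} t * exp (- (t * (2 * p)))) * (exp (- w\<^sup>2) * cos (2 * d * t * w)))"
      unfolding h_def by (intro Bochner_Integration.integral_cong) (auto simp: mult_ac)
    also have "\<dots> = (indicator {0<..} t * exp (- (t * (2 * p)))) * (sqrt pi * exp (- (2 * d * t)\<^sup>2 / 4))"
      by (simp add: integral_gaussian_cos)
    also have "\<dots> = sqrt pi * (indicator {0<..} t * (exp (- (d\<^sup>2 * t\<^sup>2)) * exp (- (2 * t * p))))"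
      by (simp add: power_mult_distrib mult_ac)
    also have "exp (- (d\<^sup>2 * t\<^sup>2)) * exp (- (2 * t * p)) = exp (- (d\<^sup>2 * t\<^sup>2) - 2 * t * p)"
      by (simp add: mult_exp_exp)
    finally show ?thesis .
  qed
  show ?thesis
    using lborel_pair.Fubini_integral[OF int]
    unfolding inner1 inner2 integral_mult_right_zero integral_divide_zero by simp
qed

subsection \<open>Hermite functions of negative integer order\<close>

text \<open>The real polynomial \<open>(- \<i>) ^ n * H\<^sub>n (\<i> * a)\<close>. The plus sign in
  its recurrence makes it nonnegative for \<open>a \<ge> 0\<close>, which later lets the full sum
  dominate all partial sums.\<close>

fun hermite_poly_imag :: "nat \<Rightarrow> real \<Rightarrow> real" where
  "hermite_poly_imag 0 a = 1"
| "hermite_poly_imag (Suc 0) a = 2 * a"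
| "hermite_poly_imag (Suc (Suc n)) a =
    2 * a * hermite_poly_imag (Suc n) a + 2 * of_nat (Suc n) * hermite_poly_imag n a"

lemma hermite_poly_imag_eq:
  "hermite_poly n (\<i> * of_real a) = \<i> ^ n * of_real (hermite_poly_imag n a)"
  by (induction n a rule: hermite_poly_imag.induct) (auto simp: algebra_simps)

lemma hermite_poly_imag_nonneg: "a \<ge> 0 \<Longrightarrow> hermite_poly_imag n a \<ge> 0"
  by (induction n a rule: hermite_poly_imag.induct) auto

text \<open>The formal product \<open>F\<close> of the series of \<open>exp (2 * a * t)\<close> and
  of \<open>exp (t\<^sup>2)\<close> satisfies F' = (2 a + 2 X) F, which is the recurrence of
  \<open>hermite_poly_imag\<close> after division by factorials. Convergence comes from the Cauchy
  product.\<close>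

lemma hermite_poly_imag_generating:
  "(\<lambda>n. hermite_poly_imag n a * t ^ n / fact n) sums exp (2 * a * t + t\<^sup>2)"
proof -
  define g where "g = (\<lambda>j :: nat. if even j then 1 / fact (j div 2) else 0 :: real)"
  define F where "F = fps_exp (2 * a) * Abs_fps g"
  have deriv_g: "fps_deriv (Abs_fps g) = fps_const 2 * (fps_X * Abs_fps g)"
  proof (rule fps_ext)
    fix n
    show "fps_nth (fps_deriv (Abs_fps g)) n = fps_nth (fps_const 2 * (fps_X * Abs_fps g)) n"
    proof (cases "odd n")
      case True
      then obtain m where n: "n = 2 * m + 1"
        by (auto elim: oddE)
      have "real (n + 1) * g (n + 1) = (2 * (m + 1)) / fact (m + 1)"
        by (simp add: n g_def)
      also have "\<dots> = 2 / fact m"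
        by (simp add: field_simps del: of_nat_Suc) (simp add: field_simps)
      finally show ?thesis
        by (simp add: n g_def)
    qed (auto simp: g_def)
  qed
  have deriv_F: "fps_deriv F = fps_const (2 * a) * F + fps_const 2 * (fps_X * F)"
    by (simp add: F_def deriv_g algebra_simps)
  have rec: "real (n + 1) * fps_nth F (n + 1)
      = 2 * a * fps_nth F n + 2 * (if n = 0 then 0 else fps_nth F (n - 1))" for n
    using arg_cong[OF deriv_F, of "\<lambda>f. fps_nth f n"] by simp
  have F: "fps_nth F n = hermite_poly_imag n a / fact n" for n
  proof (induction n rule: induct_nat_012)
    case 0
    show ?case by (simp add: F_def g_def)
  next
    case 1
    show ?case using rec[of 0] by (simp add: F_def g_def)
  next
    case (ge2 n)
    have "fps_nth F (Suc (Suc n)) = (2 * a * fps_nth F (Suc n) + 2 * fps_nth F n) / real (n + 2)"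
      using rec[of "Suc n"] by (simp add: field_simps)
    also have "\<dots> = (2 * a * (hermite_poly_imag (Suc n) a / (real (n + 1) * fact n))
        + 2 * (hermite_poly_imag n a / fact n)) / real (n + 2)"
      by (simp add: ge2)
    also have "\<dots> = (2 * a * hermite_poly_imag (Suc n) a + 2 * real (n + 1) * hermite_poly_imag n a)
        / (real (n + 2) * (real (n + 1) * fact n))"
    proof -
      have "(2 * a * (p1 / (k * f)) + 2 * (p0 / f)) / l = (2 * a * p1 + 2 * k * p0) / (l * (k * f))"
        if "k > 0" "f > 0" "l > 0" for k f l p0 p1 :: real
        using that by (simp add: field_simps)
      then show ?thesis by simp
    qed
    finally show ?case by simp
  qed
  have conv_g: "(\<lambda>j. g j * s ^ j) sums exp (s\<^sup>2)" for s
  proof -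
    have "(\<lambda>j. if even j then (s\<^sup>2) ^ (j div 2) / fact (j div 2) else 0) sums (0 + exp (s\<^sup>2))"
      using exp_converges[of "s\<^sup>2"] by (intro sums_if sums_zero) (simp add: field_simps)
    also have "(\<lambda>j. if even j then (s\<^sup>2) ^ (j div 2) / fact (j div 2) else 0) = (\<lambda>j. g j * s ^ j)"
      by (auto simp: fun_eq_iff g_def simp flip: power_mult)
    finally show ?thesis by simp
  qed
  have "(\<lambda>n. \<Sum>i\<le>n. ((2 * a * t) ^ i /\<^sub>R fact i) * (g (n - i) * t ^ (n - i)))
      sums ((\<Sum>i. (2 * a * t) ^ i /\<^sub>R fact i) * (\<Sum>j. g j * t ^ j))"
  proof (rule Cauchy_product_sums)
    show "summable (\<lambda>i. norm ((2 * a * t) ^ i /\<^sub>R fact i))"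
      by (rule summable_norm_exp)
    have "norm (g j * t ^ j) = g j * \<bar>t\<bar> ^ j" for j
      by (simp add: g_def abs_mult power_abs)
    then show "summable (\<lambda>j. norm (g j * t ^ j))"
      using sums_summable[OF conv_g[of "\<bar>t\<bar>"]] by simp
  qed
  also have "(\<Sum>i. (2 * a * t) ^ i /\<^sub>R fact i) * (\<Sum>j. g j * t ^ j) = exp (2 * a * t + t\<^sup>2)"
    using sums_unique[OF exp_converges[of "2 * a * t"]] sums_unique[OF conv_g[of t]]
    by (simp add: exp_add)
  also have "(\<lambda>n. \<Sum>i\<le>n. ((2 * a * t) ^ i /\<^sub>R fact i) * (g (n - i) * t ^ (n - i)))
      = (\<lambda>n. fps_nth F n * t ^ n)"
  proof
    fix n
    have "((2 * a * t) ^ i /\<^sub>R fact i) * (g (n - i) * t ^ (n - i))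
        = (2 * a) ^ i / fact i * g (n - i) * t ^ n" if "i \<le> n" for i
    proof -
      have "t ^ n = t ^ i * t ^ (n - i)"
        using that by (simp flip: power_add)
      then show ?thesis
        by (simp add: power_mult_distrib divide_inverse)
    qed
    then show "(\<Sum>i\<le>n. ((2 * a * t) ^ i /\<^sub>R fact i) * (g (n - i) * t ^ (n - i))) = fps_nth F n * t ^ n"
      by (simp add: F_def fps_mult_nth sum_distrib_right atLeast0AtMost)
  qed
  finally show ?thesis
    unfolding F by simp
qed

section \<open>Gaussian moments on the half-line and the Hermite functions of order -n-1\<close>

definition half_gauss_moment :: "nat \<Rightarrow> real" where
  "half_gauss_moment n = (LINT t|lborel. indicator {0<..} t * (t ^ n * exp (- t\<^sup>2)))"

lemma has_bochner_integral_half_gauss_moment: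
  "has_bochner_integral lborel (\<lambda>t. indicator {0<..} t * (t ^ n * exp (- t\<^sup>2))) (half_gauss_moment n)"
  "half_gauss_moment 0 = sqrt pi / 2" "half_gauss_moment (Suc 0) = 1 / 2"
  "half_gauss_moment (n + 2) = (real n + 1) / 2 * half_gauss_moment n"
proof -
  define m where "m = (\<lambda>n :: nat. if even n
    then sqrt pi / 2 * (fact (2 * (n div 2)) / (2 ^ (2 * (n div 2)) * fact (n div 2)))
    else fact (n div 2) / 2 :: real)"
  have int: "has_bochner_integral lborel (\<lambda>t. indicator {0<..} t * (t ^ n * exp (- t\<^sup>2))) (m n)" for n
  proof -
    have "has_bochner_integral lborel (\<lambda>x. indicator {0..} x *\<^sub>R (exp (- x\<^sup>2) * x ^ n)) (m n)"
      using gaussian_moment_even_pos[of "n div 2"] gaussian_moment_odd_pos[of "n div 2"]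
      by (cases "even n") (auto simp: m_def)
    then show ?thesis
      by (rule has_bochner_integral_cong_AE[THEN iffD1, rotated -1])
         (use AE_lborel_singleton[of 0] in \<open>auto split: split_indicator\<close>)
  qed
  then have m: "half_gauss_moment n = m n" for n
    unfolding half_gauss_moment_def by (rule has_bochner_integral_integral_eq)
  show "has_bochner_integral lborel (\<lambda>t. indicator {0<..} t * (t ^ n * exp (- t\<^sup>2))) (half_gauss_moment n)"
    using int m by simp
  show "half_gauss_moment 0 = sqrt pi / 2" "half_gauss_moment (Suc 0) = 1 / 2"
    by (simp_all add: m m_def)
  show "half_gauss_moment (n + 2) = (real n + 1) / 2 * half_gauss_moment n"
  proof (cases "even n")
    case True
    then obtain k where n: "n = 2 * k" by (auto elim: evenE)
    have "fact (2 * k + 2) / (2 ^ (2 * k + 2) * fact (k + 1))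
        = (2 * real k + 1) / 2 * (fact (2 * k) / (2 ^ (2 * k) * fact k) :: real)"
    proof -
      have "fact (2 * k + 2) = 2 * (real k + 1) * (2 * real k + 1) * fact (2 * k)"
        by (simp add: algebra_simps)
      moreover have "2 ^ (2 * k + 2) * fact (k + 1) = 2 * (real k + 1) * (2 * (2 ^ (2 * k) * fact k))"
        by (simp add: algebra_simps)
      moreover have "real k + 1 \<noteq> 0"
        by linarith
      ultimately show ?thesis
        by (simp only: mult.assoc mult_divide_mult_cancel_left_if) (simp add: field_simps)
    qed
    then show ?thesis
      by (simp add: m m_def n)
  next
    case False
    then obtain k where "n = 2 * k + 1" by (auto elim: oddE)
    then show ?thesis
      by (simp add: m m_def)
  qed
qed

lemma half_gauss_moment_pochhammer:
  "half_gauss_moment (n + 2 * m) = pochhammer ((real n + 1) / 2) m * half_gauss_moment n"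
proof (induction m)
  case (Suc m)
  have "half_gauss_moment (n + 2 * Suc m) = (real (n + 2 * m) + 1) / 2 * half_gauss_moment (n + 2 * m)"
    using has_bochner_integral_half_gauss_moment(4)[of "n + 2 * m"] by simp
  then show ?case
    unfolding Suc.IH by (simp add: pochhammer_Suc field_simps)
qed simp

text \<open>Legendre's duplication formula in disguise, as the moment is half the value of the Gamma
  function at (n + 1) / 2. It matches the constants in the definition of
  \<open>hermite_H\<close>.\<close>

lemma half_gauss_moment_rGamma:
  "of_real (half_gauss_moment n / fact n) = of_real (sqrt pi) / 2 ^ (n + 1) * rGamma (of_nat n / 2 + 1 :: complex)"
proof (induction n rule: induct_nat_012)
  case 0
  show ?case
    by (simp add: has_bochner_integral_half_gauss_moment rGamma_inverse_Gamma)
next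
  case 1
  have "rGamma (1 / 2 :: complex) = 1 / 2 * rGamma (3 / 2)"
    using rGamma_plus1[of "1 / 2 :: complex"] by simp
  then have "rGamma (3 / 2 :: complex) = 2 / of_real (sqrt pi)"
    by (simp add: rGamma_half)
  then show ?case
    by (simp add: has_bochner_integral_half_gauss_moment)
next
  case (ge2 n)
  have "rGamma (of_nat n / 2 + 1 :: complex) = (of_nat n / 2 + 1) * rGamma (of_nat (Suc (Suc n)) / 2 + 1)"
    using rGamma_plus1[of "of_nat n / 2 + 1 :: complex"] by (simp add: add_divide_distrib add_ac)
  moreover have nz: "of_nat n / 2 + 1 \<noteq> (0 :: complex)"
    by (simp add: complex_eq_iff)
  ultimately have r: "rGamma (of_nat (Suc (Suc n)) / 2 + 1 :: complex) = rGamma (of_nat n / 2 + 1) / (of_nat n / 2 + 1)"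
    by (simp add: field_simps)
  have "half_gauss_moment (Suc (Suc n)) / fact (Suc (Suc n)) = half_gauss_moment n / fact n / (2 * (real n + 2))"
    using has_bochner_integral_half_gauss_moment(4)[of n] by (simp add: divide_simps) (simp add: algebra_simps)
  then have "of_real (half_gauss_moment (Suc (Suc n)) / fact (Suc (Suc n)))
      = of_real (half_gauss_moment n / fact n) / (2 * (of_nat n + 2) :: complex)"
    by simp
  also have "\<dots> = of_real (sqrt pi) / 2 ^ (Suc (Suc n) + 1) * rGamma (of_nat (Suc (Suc n)) / 2 + 1 :: complex)"
  proof -
    have "of_nat n + 2 = 2 * (of_nat n / 2 + 1 :: complex)"
      by simp
    then show ?thesis
      unfolding ge2(1) r using nz by (simp add: field_simps del: of_nat_Suc)
  qed
  finally show ?case .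
qed

lemma integrable_power_exp_quadratic:
  fixes c D :: real
  assumes D: "D > 0"
  shows "integrable lborel (\<lambda>t. indicator {0<..} t * (t ^ n * exp (c * t - D * t\<^sup>2)))"
proof (rule Bochner_Integration.integrable_bound)
  \<comment> \<open>The maximum of \<open>(c + 1) * t - D * t\<^sup>2\<close>, so that the exponent
    is at most \<open>K - t\<close>.\<close>
  define K where "K = (c + 1)\<^sup>2 / (4 * D)"
  show "integrable lborel (\<lambda>t. exp K * (t ^ n * exp (- t) * indicator {0<..} t) :: real)"
    using has_bochner_integral_I0i_power_exp_m[of n] by (intro integrable_mult_right integrable.intros)
  show "AE t in lborel. norm (indicator {0<..} t * (t ^ n * exp (c * t - D * t\<^sup>2)))
      \<le> norm (exp K * (t ^ n * exp (- t) * indicator {0<..} t))"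
  proof (rule AE_I2)
    fix t :: real
    have "0 \<le> (2 * D * t - (c + 1))\<^sup>2 / (4 * D)"
      using D by simp
    also have "\<dots> = D * t\<^sup>2 - (c + 1) * t + K"
      using D by (simp add: K_def field_simps power2_eq_square)
    finally have "exp (c * t - D * t\<^sup>2) \<le> exp (K - t)"
      by (simp add: algebra_simps)
    then show "norm (indicator {0<..} t * (t ^ n * exp (c * t - D * t\<^sup>2)))
        \<le> norm (exp K * (t ^ n * exp (- t) * indicator {0<..} t))"
      by (auto simp: indicator_def exp_diff exp_minus field_simps abs_mult intro!: mult_left_mono)
  qed
qed measurable

text \<open>The classical integral representation of the Hermite function of order -n-1;
  \<open>hermite_H_neg\<close> identifies it with the definition by Kummer series.\<close>

definition hermite_neg :: "nat \<Rightarrow> real \<Rightarrow> real" where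
  "hermite_neg n b = (LINT t|lborel. indicator {0<..} t * (t ^ n * exp (- t\<^sup>2 - 2 * t * b))) / fact n"

lemma integrable_hermite_neg:
  "integrable lborel (\<lambda>t :: real. indicator {0<..} t * (t ^ n * exp (- t\<^sup>2 - 2 * t * b)))"
proof -
  have "- t\<^sup>2 - 2 * t * b = (- 2 * b) * t - 1 * t\<^sup>2" for t :: real
    by simp
  then show ?thesis
    using integrable_power_exp_quadratic[of 1 n "- 2 * b"] by (simp only: zero_less_one)
qed

lemma hermite_neg_power_series:
  "(\<lambda>j. half_gauss_moment (n + j) / fact n * (- 2 * b) ^ j / fact j) sums hermite_neg n b"
proof -
  define f where "f = (\<lambda>j t. indicator {0<..} t * (t ^ n * exp (- t\<^sup>2)) * ((- 2 * b * t) ^ j / fact j) :: real)"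
  have f: "has_bochner_integral lborel (f j) (half_gauss_moment (n + j) * (- 2 * b) ^ j / fact j)" for j
  proof -
    have "has_bochner_integral lborel
        (\<lambda>t. indicator {0<..} t * (t ^ (n + j) * exp (- t\<^sup>2)) * ((- 2 * b) ^ j / fact j))
        (half_gauss_moment (n + j) * ((- 2 * b) ^ j / fact j))"
      by (intro has_bochner_integral_mult_left has_bochner_integral_half_gauss_moment)
    moreover have "f j = (\<lambda>t. indicator {0<..} t * (t ^ (n + j) * exp (- t\<^sup>2)) * ((- 2 * b) ^ j / fact j))"
    proof -
      have "(- 2 * b * t) ^ j = (- 2 * b) ^ j * t ^ j" for t
        by (simp only: power_mult_distrib)
      then show ?thesis
        by (simp add: f_def fun_eq_iff power_add mult_ac del: mult_minus_left)
    qed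
    ultimately show ?thesis
      by simp
  qed
  have "(\<lambda>N. LINT t|lborel. (\<Sum>j<N. f j t))
      \<longlonglongrightarrow> (LINT t|lborel. indicator {0<..} t * (t ^ n * exp (- t\<^sup>2 - 2 * t * b)))"
  proof (rule integral_dominated_convergence)
    show "integrable lborel (\<lambda>t. indicator {0<..} t * (t ^ n * exp (2 * \<bar>b\<bar> * t - 1 * t\<^sup>2)))"
      by (rule integrable_power_exp_quadratic) simp
    show "AE t in lborel. (\<lambda>N. \<Sum>j<N. f j t)
        \<longlonglongrightarrow> indicator {0<..} t * (t ^ n * exp (- t\<^sup>2 - 2 * t * b))"
    proof (rule AE_I2)
      fix t :: real
      have "(\<lambda>j. indicator {0<..} t * (t ^ n * exp (- t\<^sup>2)) * ((- 2 * b * t) ^ j / fact j))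
          sums (indicator {0<..} t * (t ^ n * exp (- t\<^sup>2)) * exp (- 2 * b * t))"
        using exp_converges[of "- 2 * b * t"] by (intro sums_mult) (simp add: field_simps)
      then show "(\<lambda>N. \<Sum>j<N. f j t)
          \<longlonglongrightarrow> indicator {0<..} t * (t ^ n * exp (- t\<^sup>2 - 2 * t * b))"
        by (simp add: f_def sums_def mult.assoc mult_exp_exp mult.commute[of b])
    qed
    show "AE t in lborel. norm (\<Sum>j<N. f j t)
        \<le> indicator {0<..} t * (t ^ n * exp (2 * \<bar>b\<bar> * t - 1 * t\<^sup>2))" for N
    proof (rule AE_I2)
      fix t :: real
      show "norm (\<Sum>j<N. f j t) \<le> indicator {0<..} t * (t ^ n * exp (2 * \<bar>b\<bar> * t - 1 * t\<^sup>2))"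
      proof (cases "t > 0")
        case True
        have "norm (\<Sum>j<N. f j t) \<le> (\<Sum>j<N. norm (f j t))"
          by (rule norm_sum)
        also have "\<dots> = t ^ n * exp (- t\<^sup>2) * (\<Sum>j<N. (2 * \<bar>b\<bar> * t) ^ j / fact j)"
          using True by (simp add: f_def abs_mult power_abs sum_distrib_left)
        also have "\<dots> \<le> t ^ n * exp (- t\<^sup>2) * exp (2 * \<bar>b\<bar> * t)"
        proof (intro mult_left_mono)
          have "(\<lambda>j. (2 * \<bar>b\<bar> * t) ^ j / fact j) sums exp (2 * \<bar>b\<bar> * t)"
            using exp_converges[of "2 * \<bar>b\<bar> * t"] by (simp add: field_simps)
          then show "(\<Sum>j<N. (2 * \<bar>b\<bar> * t) ^ j / fact j) \<le> exp (2 * \<bar>b\<bar> * t)"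
            using True sum_le_suminf[of "\<lambda>j. (2 * \<bar>b\<bar> * t) ^ j / fact j" "{..<N}"]
            by (simp add: sums_iff)
        qed (use True in auto)
        also have "\<dots> = t ^ n * exp (2 * \<bar>b\<bar> * t - 1 * t\<^sup>2)"
          by (simp add: mult.assoc mult_exp_exp)
        finally show ?thesis
          using True by simp
      qed (simp add: f_def)
    qed
  qed (simp_all add: f_def)
  also have "(\<lambda>N. LINT t|lborel. (\<Sum>j<N. f j t))
      = (\<lambda>N. \<Sum>j<N. half_gauss_moment (n + j) * (- 2 * b) ^ j / fact j)"
    using f by (simp add: has_bochner_integral_iff Bochner_Integration.integral_sum)
  finally have "(\<lambda>j. half_gauss_moment (n + j) * (- 2 * b) ^ j / fact j)
      sums (LINT t|lborel. indicator {0<..} t * (t ^ n * exp (- t\<^sup>2 - 2 * t * b)))"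
    by (simp add: sums_def)
  from sums_divide[OF this, of "fact n"] show ?thesis
    by (simp add: hermite_neg_def field_simps)
qed

text \<open>Expanding \<open>exp (- 2 * t * b)\<close> under the integral gives a power series in
  \<open>b\<close>. Its even terms form the first Kummer series and its odd terms the second, the
  moments of step two producing the Pochhammer symbols.\<close>

theorem hermite_H_neg: "hermite_H (- of_nat n - 1) (of_real b) = of_real (hermite_neg n b)"
proof -
  define t where "t = (\<lambda>j. half_gauss_moment (n + j) / fact n * (- 2 * b) ^ j / fact j)"
  define \<nu> where "\<nu> = (- of_nat n - 1 :: complex)"
  have sum_t: "(\<lambda>m. complex_of_real (t (2 * m) + t (2 * m + 1))) sums of_real (hermite_neg n b)"
  proof -
    have "(\<lambda>m. sum t {m * 2..<m * 2 + 2}) sums hermite_neg n b"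
      using hermite_neg_power_series[of n b] by (intro sums_group) (auto simp: t_def)
    then show ?thesis
      by (intro sums_of_real) (simp add: mult.commute)
  qed
  define \<alpha> \<beta> where "\<alpha> = 2 powr \<nu> * of_real (sqrt pi) * rGamma ((1 - \<nu>) / 2)"
    and "\<beta> = 2 powr (\<nu> + 1) * of_real (sqrt pi) * rGamma (- \<nu> / 2) * of_real b"
  define ev od where "ev = (\<lambda>m. pochhammer (- \<nu> / 2) m * (of_real b)\<^sup>2 ^ m / (pochhammer (1 / 2) m * fact m))"
    and "od = (\<lambda>m. pochhammer ((1 - \<nu>) / 2) m * (of_real b)\<^sup>2 ^ m / (pochhammer (3 / 2) m * fact m))"
  have "(\<lambda>m. \<alpha> * ev m - \<beta> * od m) sums hermite_H \<nu> (of_real b)"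
    unfolding hermite_H_def \<alpha>_def \<beta>_def ev_def od_def
    by (intro sums_diff sums_mult kummer_M_sums) auto
  moreover have half_fact: "pochhammer (1 / 2 :: complex) m * fact m = fact (2 * m) / 4 ^ m" for m
    using fact_double[of m, where 'a = complex] by (simp add: power_mult)
  moreover have "\<alpha> * ev m = of_real (t (2 * m))" for m
  proof -
    have "\<alpha> = of_real (half_gauss_moment n / fact n)"
    proof -
      have e1: "(1 - \<nu>) / 2 = of_nat n / 2 + 1"
        by (simp add: \<nu>_def field_simps)
      have e2: "2 powr \<nu> = 1 / 2 ^ (n + 1)"
        by (simp add: \<nu>_def powr_diff powr_minus powr_nat field_simps)
      show ?thesis
        unfolding \<alpha>_def half_gauss_moment_rGamma e1 e2 by simp
    qed
    moreover note half_fact[of m]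
    moreover have "- \<nu> / 2 = of_real ((real n + 1) / 2)"
      by (simp add: \<nu>_def)
    ultimately show ?thesis
      unfolding ev_def t_def half_gauss_moment_pochhammer
      by (simp add: pochhammer_of_real power_mult power_mult_distrib del: of_real_divide of_real_add)
         (simp add: mult_ac)
  qed
  moreover have "\<beta> * od m = - of_real (t (2 * m + 1))" for m
  proof -
    have "\<beta> = of_real (2 * half_gauss_moment (n + 1) / fact n * b)"
    proof -
      have e1: "- \<nu> / 2 = (of_nat n + 1) / 2"
        by (simp add: \<nu>_def field_simps)
      have e2: "2 powr (\<nu> + 1) = 1 / 2 ^ n"
        by (simp add: \<nu>_def powr_minus powr_nat field_simps)
      have e3: "rGamma ((of_nat n + 1) / 2 :: complex)
          = (of_nat n + 1) / 2 * rGamma (of_nat (n + 1) / 2 + 1)"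
        using rGamma_plus1[of "(of_nat n + 1) / 2 :: complex"] by (simp add: add.commute)
      have e4: "of_real (2 * half_gauss_moment (n + 1) / fact n)
          = 2 * (of_nat n + 1) * complex_of_real (half_gauss_moment (n + 1) / fact (n + 1))"
      proof -
        have "2 * h / f = 2 * k * (h / (k * f))" if "k > 0" for k h f :: real
          using that by simp
        from this[of "real n + 1"] have "2 * half_gauss_moment (n + 1) / fact n
            = 2 * (real n + 1) * (half_gauss_moment (n + 1) / fact (n + 1))"
          by (simp add: add.commute)
        from arg_cong[OF this, of complex_of_real] show ?thesis
          by (simp only: of_real_mult of_real_add of_real_of_nat_eq of_real_numeral of_real_1)
      qed
      show ?thesis
        unfolding \<beta>_def of_real_mult[of _ b] e4 half_gauss_moment_rGamma e1 e2 e3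
        by (simp add: field_simps)
    qed
    moreover have "pochhammer (3 / 2 :: complex) m * fact m = fact (2 * m + 1) / 4 ^ m"
    proof -
      have "pochhammer (3 / 2 :: complex) m = (2 * of_nat m + 1) * pochhammer (1 / 2) m"
      proof -
        have "pochhammer (3 / 2 :: complex) m = 2 * pochhammer (1 / 2) (Suc m)"
          by (simp add: pochhammer_rec)
        moreover have "2 * (x * (1 / 2 + y)) = (2 * y + 1) * x" for x y :: complex
          by (simp add: algebra_simps)
        ultimately show ?thesis
          unfolding pochhammer_Suc by simp
      qed
      then have "pochhammer (3 / 2 :: complex) m * fact m
          = (2 * of_nat m + 1) * (pochhammer (1 / 2) m * fact m)"
        by simp
      also have "\<dots> = (2 * of_nat m + 1) * (fact (2 * m) / 4 ^ m)"
        unfolding half_fact ..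
      finally show ?thesis
        by (simp add: add.commute)
    qed
    moreover have "(1 - \<nu>) / 2 = of_real ((real (n + 1) + 1) / 2)"
      by (simp add: \<nu>_def)
    moreover have "half_gauss_moment (n + (2 * m + 1))
        = pochhammer ((real (n + 1) + 1) / 2) m * half_gauss_moment (n + 1)"
      using half_gauss_moment_pochhammer[of "n + 1" m] by (simp add: add_ac)
    ultimately show ?thesis
      unfolding od_def t_def
      by (simp add: pochhammer_of_real power_mult power_mult_distrib del: of_real_divide of_real_add)
         (simp add: mult_ac)
  qed
  ultimately have "(\<lambda>m. complex_of_real (t (2 * m) + t (2 * m + 1))) sums hermite_H \<nu> (of_real b)"
    by simp
  with sum_t show ?thesis
    unfolding \<nu>_def by (rule sums_unique2[symmetric])
qed

text \<open>Leaving out \<open>z = 0\<close> in the hypothesis lets the induction divide by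
  \<open>z\<close> and pass to the shifted coefficients; \<open>c 0\<close> is recovered as a
  limit.\<close>

lemma powser_eq_0_imp_coeff_eq_0:
  fixes c :: "nat \<Rightarrow> real"
  assumes "\<And>z. z \<noteq> 0 \<Longrightarrow> \<bar>z\<bar> < 1 \<Longrightarrow> (\<lambda>n. c n * z ^ n) sums 0"
  shows "c k = 0"
proof -
  have base: "c 0 = 0"
    if "\<And>z. z \<noteq> 0 \<Longrightarrow> \<bar>z\<bar> < 1 \<Longrightarrow> (\<lambda>n. c n * z ^ n) sums 0" for c :: "nat \<Rightarrow> real"
  proof -
    have "((\<lambda>_. 0) \<longlongrightarrow> c 0) (at (0 :: real))"
      by (rule powser_limit_0_strong[of 1]) (use that in auto)
    then show ?thesis
      using LIM_const_eq by metis
  qed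
  show ?thesis
    using assms
  proof (induction k arbitrary: c)
    case (0 c)
    then show ?case by (rule base)
  next
    case (Suc k c)
    have c0: "c 0 = 0"
      using Suc.prems by (rule base)
    show ?case
    proof (rule Suc.IH)
      fix z :: real
      assume z: "z \<noteq> 0" "\<bar>z\<bar> < 1"
      have "(\<lambda>n. c (Suc n) * z ^ Suc n) sums 0"
        using Suc.prems[OF z] sums_Suc_iff[of "\<lambda>n. c n * z ^ n" 0] by (simp add: c0)
      from sums_divide[OF this, of z] z show "(\<lambda>n. c (Suc n) * z ^ n) sums 0"
        by (simp add: field_simps)
    qed
  qed
qed

section \<open>Moments in tanh u and the product formula\<close>

definition tanh_moment :: "nat \<Rightarrow> real \<Rightarrow> real \<Rightarrow> real" where
  "tanh_moment n a b = (LINT u|lborel. tanh u ^ n * product_weight a b u)"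

lemma tanh_moment_generating:
  assumes z: "\<bar>z\<bar> < 1"
  shows "(\<lambda>n. tanh_moment n a b * z ^ n) sums (LINT u|lborel. product_weight a b u / (1 - z * tanh u))"
proof -
  have "(\<lambda>N. LINT u|lborel. (\<Sum>n<N. z ^ n * (tanh u ^ n * product_weight a b u)))
      \<longlonglongrightarrow> (LINT u|lborel. product_weight a b u / (1 - z * tanh u))"
  proof (rule integral_dominated_convergence)
    show "integrable lborel (\<lambda>u :: real. 1 / (1 - \<bar>z\<bar>) * (1 / cosh u))"
      by (intro integrable_mult_right integrable_inverse_cosh)
    have lt: "\<bar>z * tanh u\<bar> \<le> \<bar>z\<bar>" for u
    proof -
      have "\<bar>z\<bar> * \<bar>tanh u\<bar> \<le> \<bar>z\<bar> * 1"
        using abs_tanh_less_1[of u] by (intro mult_left_mono) auto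
      then show ?thesis by (simp add: abs_mult)
    qed
    show "AE u in lborel. (\<lambda>N. \<Sum>n<N. z ^ n * (tanh u ^ n * product_weight a b u))
        \<longlonglongrightarrow> product_weight a b u / (1 - z * tanh u)"
    proof (rule AE_I2)
      fix u
      have "(\<lambda>n. (z * tanh u) ^ n * product_weight a b u) sums (1 / (1 - z * tanh u) * product_weight a b u)"
        using lt[of u] z by (intro sums_mult2 geometric_sums) auto
      then show "(\<lambda>N. \<Sum>n<N. z ^ n * (tanh u ^ n * product_weight a b u))
          \<longlonglongrightarrow> product_weight a b u / (1 - z * tanh u)"
        by (simp add: sums_def power_mult_distrib mult.assoc)
    qed
    show "AE u in lborel. norm (\<Sum>n<N. z ^ n * (tanh u ^ n * product_weight a b u))
        \<le> 1 / (1 - \<bar>z\<bar>) * (1 / cosh u)" for N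
    proof (rule AE_I2)
      fix u
      have "norm (\<Sum>n<N. z ^ n * (tanh u ^ n * product_weight a b u))
          \<le> (\<Sum>n<N. norm (z ^ n * (tanh u ^ n * product_weight a b u)))"
        by (rule norm_sum)
      also have "\<dots> = (\<Sum>n<N. \<bar>z * tanh u\<bar> ^ n) * product_weight a b u"
        by (simp add: sum_distrib_right abs_mult power_abs power_mult_distrib mult.assoc)
      also have "\<dots> \<le> (\<Sum>n<N. \<bar>z\<bar> ^ n) * (1 / cosh u)"
        using lt by (intro mult_mono sum_mono power_mono sum_nonneg product_weight_le) auto
      also have "(\<Sum>n<N. \<bar>z\<bar> ^ n) \<le> (\<Sum>n. \<bar>z\<bar> ^ n)"
        using z by (intro sum_le_suminf summable_geometric) auto
      also have "(\<Sum>n. \<bar>z\<bar> ^ n) = 1 / (1 - \<bar>z\<bar>)"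
        using z by (intro suminf_geometric) auto
      finally show "norm (\<Sum>n<N. z ^ n * (tanh u ^ n * product_weight a b u))
          \<le> 1 / (1 - \<bar>z\<bar>) * (1 / cosh u)"
        by (simp add: divide_right_mono)
    qed
  qed measurable
  also have "(\<lambda>N. LINT u|lborel. (\<Sum>n<N. z ^ n * (tanh u ^ n * product_weight a b u)))
      = (\<lambda>N. \<Sum>n<N. tanh_moment n a b * z ^ n)"
  proof
    fix N
    show "(LINT u|lborel. (\<Sum>n<N. z ^ n * (tanh u ^ n * product_weight a b u)))
        = (\<Sum>n<N. tanh_moment n a b * z ^ n)"
      by (subst Bochner_Integration.integral_sum)
         (auto simp: tanh_moment_def mult.commute[of _ "z ^ _"] intro!: integrable_tanh_power_product_weight)
  qed
  finally show ?thesis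
    by (simp add: sums_def)
qed

text \<open>The generating function of \<open>hermite_poly_imag\<close> is summed inside the
  integral defining \<open>hermite_neg\<close>. By nonnegativity the partial sums are bounded by the
  full sum at \<open>\<bar>z\<bar>\<close>, which is integrable because \<open>z\<^sup>2 < 1\<close>
  leaves a decaying Gaussian.\<close>

lemma hermite_product_generating:
  assumes a: "a \<ge> 0" and z: "\<bar>z\<bar> < 1"
  shows "(\<lambda>n. hermite_poly_imag n a * hermite_neg n b * z ^ n)
    sums (LINT t|lborel. indicator {0<..} t * exp (- ((1 - z\<^sup>2) * t\<^sup>2) - 2 * t * (b - z * a)))"
proof -
  define f where "f = (\<lambda>n t. hermite_poly_imag n a * z ^ n / fact n
    * (indicator {0<..} t * (t ^ n * exp (- t\<^sup>2 - 2 * t * b))) :: real)"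
  have pos: "1 - z\<^sup>2 > 0"
    using z by (simp add: abs_square_less_1)
  have "(\<lambda>N. LINT t|lborel. (\<Sum>n<N. f n t))
      \<longlonglongrightarrow> (LINT t|lborel. indicator {0<..} t * exp (- ((1 - z\<^sup>2) * t\<^sup>2) - 2 * t * (b - z * a)))"
  proof (rule integral_dominated_convergence)
    show "integrable lborel (\<lambda>t. indicator {0<..} t * (t ^ 0 * exp ((2 * a * \<bar>z\<bar> - 2 * b) * t - (1 - z\<^sup>2) * t\<^sup>2)))"
      by (rule integrable_power_exp_quadratic[OF pos])
    have f_eq: "f n t = indicator {0<..} t * exp (- t\<^sup>2 - 2 * t * b) * (hermite_poly_imag n a * (z * t) ^ n / fact n)" for n t
      by (simp add: f_def power_mult_distrib)
    show "AE t in lborel. (\<lambda>N. \<Sum>n<N. f n t)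
        \<longlonglongrightarrow> indicator {0<..} t * exp (- ((1 - z\<^sup>2) * t\<^sup>2) - 2 * t * (b - z * a))"
    proof (rule AE_I2)
      fix t :: real
      have "(\<lambda>n. f n t) sums (indicator {0<..} t * exp (- t\<^sup>2 - 2 * t * b) * exp (2 * a * (z * t) + (z * t)\<^sup>2))"
        unfolding f_eq by (intro sums_mult hermite_poly_imag_generating)
      also have "indicator {0<..} t * exp (- t\<^sup>2 - 2 * t * b) * exp (2 * a * (z * t) + (z * t)\<^sup>2)
          = indicator {0<..} t * exp (- ((1 - z\<^sup>2) * t\<^sup>2) - 2 * t * (b - z * a))"
        by (simp add: mult.assoc mult_exp_exp) (simp add: algebra_simps power_mult_distrib)
      finally show "(\<lambda>N. \<Sum>n<N. f n t)
          \<longlonglongrightarrow> indicator {0<..} t * exp (- ((1 - z\<^sup>2) * t\<^sup>2) - 2 * t * (b - z * a))"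
        by (simp add: sums_def)
    qed
    show "AE t in lborel. norm (\<Sum>n<N. f n t)
        \<le> indicator {0<..} t * (t ^ 0 * exp ((2 * a * \<bar>z\<bar> - 2 * b) * t - (1 - z\<^sup>2) * t\<^sup>2))" for N
    proof (rule AE_I2)
      fix t :: real
      show "norm (\<Sum>n<N. f n t)
          \<le> indicator {0<..} t * (t ^ 0 * exp ((2 * a * \<bar>z\<bar> - 2 * b) * t - (1 - z\<^sup>2) * t\<^sup>2))"
      proof (cases "t > 0")
        case True
        have "norm (\<Sum>n<N. f n t) \<le> (\<Sum>n<N. norm (f n t))"
          by (rule norm_sum)
        also have "\<dots> = exp (- t\<^sup>2 - 2 * t * b) * (\<Sum>n<N. hermite_poly_imag n a * (\<bar>z\<bar> * t) ^ n / fact n)"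
          using True hermite_poly_imag_nonneg[OF a]
          by (simp add: f_eq abs_mult power_abs sum_distrib_left)
        also have "\<dots> \<le> exp (- t\<^sup>2 - 2 * t * b) * exp (2 * a * (\<bar>z\<bar> * t) + (\<bar>z\<bar> * t)\<^sup>2)"
          using True hermite_poly_imag_nonneg[OF a] hermite_poly_imag_generating[of a "\<bar>z\<bar> * t"]
            sum_le_suminf[of "\<lambda>n. hermite_poly_imag n a * (\<bar>z\<bar> * t) ^ n / fact n" "{..<N}"]
          by (intro mult_left_mono) (auto simp: sums_iff)
        also have "\<dots> = exp ((2 * a * \<bar>z\<bar> - 2 * b) * t - (1 - z\<^sup>2) * t\<^sup>2)"
          by (simp add: mult_exp_exp) (simp add: algebra_simps power_mult_distrib)
        finally show ?thesis
          using True by simp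
      qed (simp add: f_def)
    qed
  qed (simp_all add: f_def)
  also have "(\<lambda>N. LINT t|lborel. (\<Sum>n<N. f n t))
      = (\<lambda>N. \<Sum>n<N. hermite_poly_imag n a * hermite_neg n b * z ^ n)"
  proof
    fix N
    have "has_bochner_integral lborel (f n) (hermite_poly_imag n a * z ^ n / fact n
        * (LINT t|lborel. indicator {0<..} t * (t ^ n * exp (- t\<^sup>2 - 2 * t * b))))" for n
      unfolding f_def
      by (rule has_bochner_integral_mult_right[OF has_bochner_integral_integrable[OF integrable_hermite_neg]])
    moreover have "hermite_poly_imag n a * z ^ n / fact n
        * (LINT t|lborel. indicator {0<..} t * (t ^ n * exp (- t\<^sup>2 - 2 * t * b)))
      = hermite_poly_imag n a * hermite_neg n b * z ^ n" for n
      by (simp add: hermite_neg_def)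
    ultimately have "has_bochner_integral lborel (f n) (hermite_poly_imag n a * hermite_neg n b * z ^ n)" for n
      by simp
    then show "(LINT t|lborel. (\<Sum>n<N. f n t))
        = (\<Sum>n<N. hermite_poly_imag n a * hermite_neg n b * z ^ n)"
      by (simp add: has_bochner_integral_iff Bochner_Integration.integral_sum)
  qed
  finally show ?thesis
    by (simp add: sums_def)
qed

text \<open>Both sides have the same generating function for \<open>\<bar>z\<bar> < 1\<close>,
  namely the integral over t > 0 in \<open>lorentz_gauss_integral\<close> with
  \<open>d\<^sup>2 = 1 - z\<^sup>2\<close> and \<open>p = b - z * a\<close>.\<close>

lemma hermite_product_strict:
  assumes a: "a \<ge> 0" and ab: "a < b"
  shows "2 * sqrt pi * (hermite_poly_imag n a * hermite_neg n b) = tanh_moment n a b"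
proof -
  have "2 * sqrt pi * (hermite_poly_imag n a * hermite_neg n b) - tanh_moment n a b = 0"
  proof (rule powser_eq_0_imp_coeff_eq_0[of "\<lambda>n. 2 * sqrt pi * (hermite_poly_imag n a * hermite_neg n b) - tanh_moment n a b"])
    fix z :: real
    assume z: "\<bar>z\<bar> < 1"
    define d where "d = sqrt (1 - z\<^sup>2)"
    have d: "d\<^sup>2 = 1 - z\<^sup>2"
      using z by (simp add: d_def abs_square_le_1)
    have p: "b - z * a > 0"
    proof -
      have "z * a \<le> 1 * a"
        using a z by (intro mult_right_mono) auto
      then show ?thesis using ab by linarith
    qed
    have "(\<lambda>n. 2 * sqrt pi * (hermite_poly_imag n a * hermite_neg n b * z ^ n) - tanh_moment n a b * z ^ n)
        sums (2 * sqrt pi * (LINT t|lborel. indicator {0<..} t * exp (- ((1 - z\<^sup>2) * t\<^sup>2) - 2 * t * (b - z * a)))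
          - (LINT u|lborel. product_weight a b u / (1 - z * tanh u)))"
      by (intro sums_diff sums_mult hermite_product_generating tanh_moment_generating a z)
    also have "(LINT u|lborel. product_weight a b u / (1 - z * tanh u))
        = (LINT w|lborel. exp (- w\<^sup>2) * (b - z * a) / (d\<^sup>2 * w\<^sup>2 + (b - z * a)\<^sup>2))"
      unfolding d using a ab by (intro product_weight_generating_integral z) auto
    also have "\<dots> = 2 * sqrt pi * (LINT t|lborel. indicator {0<..} t * exp (- (d\<^sup>2 * t\<^sup>2) - 2 * t * (b - z * a)))"
      by (rule lorentz_gauss_integral[OF p])
    finally show "(\<lambda>n. (2 * sqrt pi * (hermite_poly_imag n a * hermite_neg n b) - tanh_moment n a b) * z ^ n) sums 0"
      by (simp add: d algebra_simps)
  qed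
  then show ?thesis by simp
qed

text \<open>At \<open>a = b\<close> the substitution degenerates, since
  \<open>b * sinh u - a * cosh u\<close> is then \<open>- b * exp (- u)\<close>. The formula extends
  by letting the second argument decrease to \<open>b\<close>. This case is needed for two points
  with equal \<eta>-coordinates.\<close>

theorem hermite_product:
  assumes a: "a \<ge> 0" and ab: "a \<le> b"
  shows "2 * sqrt pi * (hermite_poly_imag n a * hermite_neg n b) = tanh_moment n a b"
proof -
  define b' where "b' = (\<lambda>m. b + 1 / real (Suc m))"
  have b': "b' \<longlonglongrightarrow> b" "\<And>m. b' m > b"
  proof -
    have "(\<lambda>m. b + 1 / real (Suc m)) \<longlonglongrightarrow> b + 0"
      by (intro tendsto_add tendsto_const LIMSEQ_Suc lim_1_over_n)
    then show "b' \<longlonglongrightarrow> b"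
      by (simp add: b'_def)
  qed (simp add: b'_def)
  have "(\<lambda>m. LINT t|lborel. indicator {0<..} t * (t ^ n * exp (- t\<^sup>2 - 2 * t * b' m)))
      \<longlonglongrightarrow> (LINT t|lborel. indicator {0<..} t * (t ^ n * exp (- t\<^sup>2 - 2 * t * b)))"
  proof (rule integral_dominated_convergence[OF _ _ integrable_hermite_neg])
    show "AE t in lborel. (\<lambda>m. indicator {0<..} t * (t ^ n * exp (- t\<^sup>2 - 2 * t * b' m)))
        \<longlonglongrightarrow> indicator {0<..} t * (t ^ n * exp (- t\<^sup>2 - 2 * t * b))"
      by (intro AE_I2 tendsto_intros b')
    show "AE t in lborel. norm (indicator {0<..} t * (t ^ n * exp (- t\<^sup>2 - 2 * t * b' m)))
        \<le> indicator {0<..} t * (t ^ n * exp (- t\<^sup>2 - 2 * t * b))" for m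
      using b'(2)[of m] by (intro AE_I2) (auto simp: indicator_def abs_mult intro!: mult_left_mono)
  qed simp_all
  then have neg: "(\<lambda>m. hermite_neg n (b' m)) \<longlonglongrightarrow> hermite_neg n b"
    unfolding hermite_neg_def by (intro tendsto_divide tendsto_const) auto
  have moment: "(\<lambda>m. tanh_moment n a (b' m)) \<longlonglongrightarrow> tanh_moment n a b"
    unfolding tanh_moment_def
  proof (rule integral_dominated_convergence[OF _ _ integrable_inverse_cosh])
    show "AE u in lborel. (\<lambda>m. tanh u ^ n * product_weight a (b' m) u) \<longlonglongrightarrow> tanh u ^ n * product_weight a b u"
      unfolding product_weight_def by (intro AE_I2 tendsto_intros b') auto
    show "AE u in lborel. norm (tanh u ^ n * product_weight a (b' m) u) \<le> 1 / cosh u" for m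
    proof (rule AE_I2)
      fix u :: real
      have "\<bar>tanh u\<bar> ^ n * product_weight a (b' m) u \<le> 1 * (1 / cosh u)"
        using abs_tanh_less_1[of u] product_weight_le[of a "b' m" u]
        by (intro mult_mono power_le_one) auto
      then show "norm (tanh u ^ n * product_weight a (b' m) u) \<le> 1 / cosh u"
        by (simp add: abs_mult power_abs)
    qed
  qed measurable
  have "(\<lambda>m. 2 * sqrt pi * (hermite_poly_imag n a * hermite_neg n (b' m)))
      \<longlonglongrightarrow> 2 * sqrt pi * (hermite_poly_imag n a * hermite_neg n b)"
    by (intro tendsto_mult tendsto_const neg)
  moreover have "2 * sqrt pi * (hermite_poly_imag n a * hermite_neg n (b' m)) = tanh_moment n a (b' m)" for m
    using b'(2)[of m] ab by (intro hermite_product_strict a) auto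
  ultimately show ?thesis
    using moment by (metis (no_types, lifting) LIMSEQ_unique ext)
qed

subsection \<open>Summing the series\<close>

lemma product_weight_minus: "product_weight a b (- u) = product_weight a (- b) u"
  by (simp add: product_weight_def)

text \<open>The geometric sum \<open>1 / (1 - tanh u)\<close> is at most
  \<open>2 * (cosh u)\<^sup>2\<close>, and for \<open>a \<noteq> b\<close> the Gaussian compensates
  this growth because its argument is essentially \<open>(b - a) * cosh u\<close>.\<close>

lemma exp_hyperbolic_le:
  fixes a b u :: real
  assumes ab: "a \<noteq> b" and u: "u \<ge> 0"
  shows "exp (- (b * sinh u - a * cosh u)\<^sup>2) / (1 - tanh u) \<le> 4 * exp (b\<^sup>2) / (b - a)\<^sup>2"
proof -
  \<comment> \<open>As \<open>sinh u = cosh u - exp (- u)\<close>, the argument of the Gaussian is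
    \<open>X - Y\<close> with \<open>Y\<close> bounded by \<open>\<bar>b\<bar>\<close> in absolute
    value.\<close>
  define X Y where "X = (b - a) * cosh u" and "Y = b * exp (- u)"
  have e: "cosh u - sinh u = exp (- u)"
    by (simp add: cosh_field_def sinh_field_def field_simps)
  then have "b * sinh u - a * cosh u = X - Y"
    by (simp add: X_def Y_def algebra_simps flip: e)
  moreover have "X\<^sup>2 / 2 - Y\<^sup>2 \<le> (X - Y)\<^sup>2"
    using zero_le_power2[of "X / 2 - Y"] zero_le_power2[of "X - 2 * Y"]
    by (simp add: power2_eq_square algebra_simps)
  moreover have "Y\<^sup>2 \<le> b\<^sup>2"
    using u by (simp add: Y_def power_mult_distrib mult_left_le power_le_one)
  ultimately have "exp (- (b * sinh u - a * cosh u)\<^sup>2) \<le> exp (b\<^sup>2 - X\<^sup>2 / 2)"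
    by simp
  also have "\<dots> = exp (b\<^sup>2) * exp (- (X\<^sup>2 / 2))"
    by (simp add: mult_exp_exp)
  also have "\<dots> \<le> exp (b\<^sup>2) * (2 / X\<^sup>2)"
  proof (intro mult_left_mono)
    have X: "X\<^sup>2 / 2 > 0"
      using ab by (simp add: X_def)
    have "X\<^sup>2 / 2 \<le> exp (X\<^sup>2 / 2)"
      using exp_ge_add_one_self[of "X\<^sup>2 / 2"] by linarith
    then have "1 / exp (X\<^sup>2 / 2) \<le> 1 / (X\<^sup>2 / 2)"
      using X by (intro divide_left_mono) auto
    then show "exp (- (X\<^sup>2 / 2)) \<le> 2 / X\<^sup>2"
      by (simp add: exp_minus inverse_eq_divide)
  qed simp
  finally have 1: "exp (- (b * sinh u - a * cosh u)\<^sup>2) \<le> exp (b\<^sup>2) * (2 / X\<^sup>2)" .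
  have "1 / (1 - tanh u) = cosh u / (cosh u - sinh u)"
    by (simp add: tanh_def field_simps)
  also have "\<dots> = cosh u * exp u"
    unfolding e by (simp add: exp_minus field_simps)
  also have "\<dots> \<le> cosh u * (2 * cosh u)"
    by (intro mult_left_mono) (auto simp: cosh_field_def)
  finally have 2: "1 / (1 - tanh u) \<le> 2 * (cosh u)\<^sup>2"
    by (simp add: power2_eq_square mult_ac)
  have "exp (- (b * sinh u - a * cosh u)\<^sup>2) * (1 / (1 - tanh u))
      \<le> exp (b\<^sup>2) * (2 / X\<^sup>2) * (2 * (cosh u)\<^sup>2)"
    using 1 2 tanh_real_lt_1[of u] by (intro mult_mono) auto
  also have "\<dots> = 4 * exp (b\<^sup>2) / (b - a)\<^sup>2"
    by (simp add: X_def power_mult_distrib)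
  finally show ?thesis
    by simp
qed

text \<open>When \<open>a = b\<close> the series converges only conditionally, and a bound that is uniform in \<open>N\<close>
  comes from the Christoffel--Darboux formula and Abel summation; when \<open>a \<noteq> b\<close> the Gaussian factor
  decays at both ends and the trivial bound on the coefficients suffices.\<close>

lemma product_weight_partial_sums_bound_nonneg:
  assumes ne: "x \<noteq> y \<or> a \<noteq> b"
  shows "\<exists>K. \<forall>N. \<forall>u\<ge>0. product_weight a b u * \<bar>\<Sum>n<N. mehler_coeff x y n * tanh u ^ n\<bar> \<le> K * (1 / cosh u)"
proof (cases "x = y")
  case False
  then obtain K where K: "\<And>N. \<bar>\<Sum>n<N. mehler_coeff x y n\<bar> \<le> K"
    using mehler_coeff_partial_sums_bounded by blast
  have "product_weight a b u * \<bar>\<Sum>n<N. mehler_coeff x y n * tanh u ^ n\<bar> \<le> 1 / cosh u * K"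
    if u: "u \<ge> 0" for N and u :: real
    using abel_partial_sums_bound[OF K, of "tanh u" N] u tanh_real_lt_1[of u]
    by (intro mult_mono product_weight_le) auto
  then show ?thesis
    by (auto simp: mult.commute)
next
  case True
  with ne have ab: "a \<noteq> b" by simp
  obtain C where C: "C \<ge> 0" "\<And>n. \<bar>mehler_coeff x y n\<bar> \<le> C"
    using abs_mehler_coeff_bounded[of x y] by auto
  have "product_weight a b u * \<bar>\<Sum>n<N. mehler_coeff x y n * tanh u ^ n\<bar>
      \<le> C * (4 * exp (b\<^sup>2) / (b - a)\<^sup>2) * (1 / cosh u)"
    if u: "u \<ge> 0" for N and u :: real
  proof -
    have r: "0 \<le> tanh u" "tanh u < 1"
      using u tanh_real_lt_1[of u] by auto
    have "\<bar>\<Sum>n<N. mehler_coeff x y n * tanh u ^ n\<bar> \<le> (\<Sum>n<N. C * tanh u ^ n)"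
      using C r by (intro order.trans[OF sum_abs] sum_mono) (auto simp: abs_mult intro!: mult_right_mono)
    also have "\<dots> = C * (\<Sum>n<N. tanh u ^ n)"
      by (simp add: sum_distrib_left)
    also have "\<dots> \<le> C * (\<Sum>n. tanh u ^ n)"
      using C r by (intro mult_left_mono sum_le_suminf summable_geometric) auto
    also have "(\<Sum>n. tanh u ^ n) = 1 / (1 - tanh u)"
      using r by (intro suminf_geometric) auto
    finally have "product_weight a b u * \<bar>\<Sum>n<N. mehler_coeff x y n * tanh u ^ n\<bar>
        \<le> product_weight a b u * (C * (1 / (1 - tanh u)))"
      by (intro mult_left_mono) auto
    also have "\<dots> = C * (exp (- (b * sinh u - a * cosh u)\<^sup>2) / (1 - tanh u)) * (1 / cosh u)"
      by (simp add: product_weight_def mult_ac)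
    also have "\<dots> \<le> C * (4 * exp (b\<^sup>2) / (b - a)\<^sup>2) * (1 / cosh u)"
      using C by (intro mult_right_mono mult_left_mono exp_hyperbolic_le ab u) auto
    finally show ?thesis .
  qed
  then show ?thesis by blast
qed

text \<open>Replacing \<open>u\<close> by \<open>- u\<close> amounts to changing the signs of
  \<open>y\<close> and \<open>b\<close>. The second hypothesis is the first one for the reflected
  data and controls the end \<open>u < 0\<close>.\<close>

lemma product_weight_partial_sums_bound:
  assumes "x \<noteq> y \<or> a \<noteq> b" "x \<noteq> - y \<or> a \<noteq> - b"
  shows "\<exists>K. \<forall>N u. product_weight a b u * \<bar>\<Sum>n<N. mehler_coeff x y n * tanh u ^ n\<bar> \<le> K * (1 / cosh u)"
proof -
  obtain K where K: "\<And>N u. u \<ge> 0 \<Longrightarrow>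
      product_weight a b u * \<bar>\<Sum>n<N. mehler_coeff x y n * tanh u ^ n\<bar> \<le> K * (1 / cosh u)"
    using product_weight_partial_sums_bound_nonneg[OF assms(1)] by auto
  obtain K' where K': "\<And>N u. u \<ge> 0 \<Longrightarrow>
      product_weight a (- b) u * \<bar>\<Sum>n<N. mehler_coeff x (- y) n * tanh u ^ n\<bar> \<le> K' * (1 / cosh u)"
    using product_weight_partial_sums_bound_nonneg[OF assms(2)] by auto
  have "product_weight a b u * \<bar>\<Sum>n<N. mehler_coeff x y n * tanh u ^ n\<bar> \<le> max K K' * (1 / cosh u)" for N u
  proof (cases "u \<ge> 0")
    case True
    have "K * (1 / cosh u) \<le> max K K' * (1 / cosh u)"
      by (intro mult_right_mono) auto
    then show ?thesis
      using K[OF True, of N] by linarith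
  next
    case False
    have "mehler_coeff x (- y) n * tanh (- u) ^ n = mehler_coeff x y n * tanh u ^ n" for n
    proof -
      have "(- 1) ^ n * (- tanh u) ^ n = tanh u ^ n"
        by (simp flip: power_mult_distrib)
      then show ?thesis
        by (simp add: mehler_coeff_minus mult.commute[of _ "mehler_coeff x y n"] mult.assoc)
    qed
    then have "product_weight a b u * \<bar>\<Sum>n<N. mehler_coeff x y n * tanh u ^ n\<bar> \<le> K' * (1 / cosh u)"
      using K'[of "- u" N] False product_weight_minus[of a "- b" u] product_weight_minus[of a "- b" "- u"] by simp
    also have "\<dots> \<le> max K K' * (1 / cosh u)"
      by (intro mult_right_mono) auto
    finally show ?thesis .
  qed
  then show ?thesis by blast
qed

text \<open>The factor \<open>1 / cosh u\<close> of the weight is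
  \<open>sqrt (1 - (tanh u)\<^sup>2)\<close> and cancels the root in Mehler's kernel. What remains
  is the exponential of a quadratic form in \<open>cosh u\<close> and \<open>sinh u\<close>.\<close>

lemma product_weight_mehler_kernel:
  "product_weight a b u * mehler_kernel x y (tanh u)
    = exp ((x\<^sup>2 + y\<^sup>2 + b\<^sup>2 - a\<^sup>2) / 2)
      * exp (- ((x\<^sup>2 + y\<^sup>2 + a\<^sup>2 + b\<^sup>2) / 2 * cosh (2 * u) - (x * y + a * b) * sinh (2 * u)))"
proof -
  define c s where "c = cosh u" and "s = sinh u"
  have c: "c > 0" and cs: "c\<^sup>2 = s\<^sup>2 + 1"
    by (simp_all add: c_def s_def cosh_square_eq)
  have t: "tanh u = s / c"
    by (simp add: tanh_def c_def s_def)
  have r2: "1 - (tanh u)\<^sup>2 = 1 / c\<^sup>2"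
  proof -
    have "1 - (s / c)\<^sup>2 = (c\<^sup>2 - s\<^sup>2) / c\<^sup>2"
      using c by (simp add: power_divide diff_divide_distrib)
    then show ?thesis
      by (simp add: t cs)
  qed
  have "(2 * tanh u * x * y - (tanh u)\<^sup>2 * (x\<^sup>2 + y\<^sup>2)) / (1 - (tanh u)\<^sup>2)
      = 2 * s * c * (x * y) - s\<^sup>2 * (x\<^sup>2 + y\<^sup>2)"
    unfolding r2 unfolding t using c by (simp add: field_simps power2_eq_square)
  moreover have "sqrt (1 - (tanh u)\<^sup>2) = 1 / c"
    unfolding r2 using c by (simp add: real_sqrt_divide)
  ultimately have "mehler_kernel x y (tanh u) = exp (2 * s * c * (x * y) - s\<^sup>2 * (x\<^sup>2 + y\<^sup>2)) * c"
    by (simp add: mehler_kernel_def)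
  then have "product_weight a b u * mehler_kernel x y (tanh u)
      = exp (- (b * s - a * c)\<^sup>2 + (2 * s * c * (x * y) - s\<^sup>2 * (x\<^sup>2 + y\<^sup>2)))"
    using c by (simp add: product_weight_def mult_exp_exp flip: c_def s_def)
  \<comment> \<open>The quadratic form is split along \<open>c\<^sup>2 - s\<^sup>2\<close>, which is
    1 and gives the constant factor, and the double-angle expressions.\<close>
  also have "- (b * s - a * c)\<^sup>2 + (2 * s * c * (x * y) - s\<^sup>2 * (x\<^sup>2 + y\<^sup>2))
      = (x\<^sup>2 + y\<^sup>2 + b\<^sup>2 - a\<^sup>2) / 2 * (c\<^sup>2 - s\<^sup>2)
        - ((x\<^sup>2 + y\<^sup>2 + a\<^sup>2 + b\<^sup>2) / 2 * (c\<^sup>2 + s\<^sup>2) - (x * y + a * b) * (2 * s * c))"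
    by (simp add: power2_eq_square field_simps)
  also have "c\<^sup>2 - s\<^sup>2 = 1"
    using cs by simp
  also have "c\<^sup>2 + s\<^sup>2 = cosh (2 * u)"
    by (simp add: c_def s_def cosh_double)
  also have "2 * s * c = sinh (2 * u)"
    by (simp add: c_def s_def sinh_double)
  finally show ?thesis
    by (simp add: mult_exp_exp)
qed

text \<open>This is \<open>2 * K\<^sub>0 (sqrt (A\<^sup>2 - B\<^sup>2))\<close> for the Macdonald function \<open>K\<^sub>0\<close>.\<close>

definition macdonald_integral :: "real \<Rightarrow> real \<Rightarrow> real" where
  "macdonald_integral A B = (LINT u|lborel. exp (- (A * cosh u - B * sinh u)))"

text \<open>Dominated convergence with a multiple of \<open>1 / cosh u\<close>, Mehler's formula at
  \<open>tanh u\<close> giving the pointwise limit. The final division by 2 comes from replacing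
  \<open>2 * u\<close> by \<open>u\<close>.\<close>

theorem mehler_tanh_moment_sums:
  assumes "x \<noteq> y \<or> a \<noteq> b" "x \<noteq> - y \<or> a \<noteq> - b"
  shows "(\<lambda>n. mehler_coeff x y n * tanh_moment n a b) sums
    (exp ((x\<^sup>2 + y\<^sup>2 + b\<^sup>2 - a\<^sup>2) / 2)
      * (macdonald_integral ((x\<^sup>2 + y\<^sup>2 + a\<^sup>2 + b\<^sup>2) / 2) (x * y + a * b) / 2))"
proof -
  define A B where "A = (x\<^sup>2 + y\<^sup>2 + a\<^sup>2 + b\<^sup>2) / 2" and "B = x * y + a * b"
  obtain K where K: "\<And>N u. product_weight a b u * \<bar>\<Sum>n<N. mehler_coeff x y n * tanh u ^ n\<bar> \<le> K * (1 / cosh u)"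
    using product_weight_partial_sums_bound[OF assms] by auto
  have "(\<lambda>N. LINT u|lborel. (\<Sum>n<N. mehler_coeff x y n * (tanh u ^ n * product_weight a b u)))
      \<longlonglongrightarrow> (LINT u|lborel. product_weight a b u * mehler_kernel x y (tanh u))"
  proof (rule integral_dominated_convergence)
    show "integrable lborel (\<lambda>u :: real. K * (1 / cosh u))"
      by (intro integrable_mult_right integrable_inverse_cosh)
    have eq: "(\<Sum>n<N. mehler_coeff x y n * (tanh u ^ n * product_weight a b u))
        = product_weight a b u * (\<Sum>n<N. mehler_coeff x y n * tanh u ^ n)" for N u
      by (simp add: sum_distrib_left mult_ac)
    show "AE u in lborel. (\<lambda>N. \<Sum>n<N. mehler_coeff x y n * (tanh u ^ n * product_weight a b u))
        \<longlonglongrightarrow> product_weight a b u * mehler_kernel x y (tanh u)"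
      unfolding eq using mehler_formula[OF abs_tanh_less_1, of x y]
      by (intro AE_I2 tendsto_mult tendsto_const) (simp add: sums_def)
    show "AE u in lborel. norm (\<Sum>n<N. mehler_coeff x y n * (tanh u ^ n * product_weight a b u))
        \<le> K * (1 / cosh u)" for N
      unfolding eq using K by (intro AE_I2) (simp add: abs_mult)
    show "(\<lambda>u. product_weight a b u * mehler_kernel x y (tanh u)) \<in> borel_measurable lborel"
      unfolding mehler_kernel_def by measurable
  qed measurable
  also have "(\<lambda>N. LINT u|lborel. (\<Sum>n<N. mehler_coeff x y n * (tanh u ^ n * product_weight a b u)))
      = (\<lambda>N. \<Sum>n<N. mehler_coeff x y n * tanh_moment n a b)"
  proof
    fix N
    show "(LINT u|lborel. (\<Sum>n<N. mehler_coeff x y n * (tanh u ^ n * product_weight a b u)))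
        = (\<Sum>n<N. mehler_coeff x y n * tanh_moment n a b)"
      by (subst Bochner_Integration.integral_sum)
         (auto simp: tanh_moment_def intro!: integrable_tanh_power_product_weight)
  qed
  also have "(LINT u|lborel. product_weight a b u * mehler_kernel x y (tanh u))
      = exp ((x\<^sup>2 + y\<^sup>2 + b\<^sup>2 - a\<^sup>2) / 2)
        * (LINT u|lborel. exp (- (A * cosh (0 + 2 * u) - B * sinh (0 + 2 * u))))"
    unfolding product_weight_mehler_kernel A_def B_def by simp
  also have "(LINT u|lborel. exp (- (A * cosh (0 + 2 * u) - B * sinh (0 + 2 * u)))) = macdonald_integral A B / 2"
    using lborel_integral_real_affine[of 2 "\<lambda>u. exp (- (A * cosh u - B * sinh u))" 0]
    by (simp add: macdonald_integral_def)
  finally show ?thesis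
    by (simp add: sums_def A_def B_def)
qed

subsection \<open>Integration over the wave number\<close>

theorem has_bochner_integral_macdonald_cos:
  fixes A B Z :: real
  assumes AB: "\<bar>B\<bar> < A"
  shows "has_bochner_integral lborel
    (\<lambda>k. indicator {0<..} k * (cos (k * Z) * macdonald_integral (k * A) (k * B)))
    (pi / sqrt (A\<^sup>2 - B\<^sup>2 + Z\<^sup>2))"
proof -
  define C where "C = (\<lambda>u. A * cosh u - B * sinh u)"
  have C: "C u > 0" for u
    unfolding C_def by (rule cosh_sinh_pos[OF AB])
  have [measurable]: "C \<in> borel_measurable borel"
    unfolding C_def by measurable
  \<comment> \<open>\<open>g\<close> is \<open>h\<close> without the cosine. Its integral over
    \<open>k\<close> is \<open>1 / C u\<close>, at most a multiple of \<open>1 / cosh u\<close>,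
    which justifies Fubini.\<close>
  define g h where "g = (\<lambda>u k :: real. indicator {0<..} k * exp (- (k * C u)))"
    and "h = (\<lambda>u k :: real. indicator {0<..} k * (exp (- (k * C u)) * cos (k * Z)))"
  have "integrable (lborel \<Otimes>\<^sub>M lborel) (case_prod g)"
  proof (rule lborel_pair.Fubini_integrable)
    show "case_prod g \<in> borel_measurable (lborel \<Otimes>\<^sub>M lborel)"
      unfolding g_def by measurable
    have g: "has_bochner_integral lborel (g u) (1 / C u)" for u
      unfolding g_def by (rule has_bochner_integral_exp_Ioi[OF C])
    then show "AE u in lborel. integrable lborel (\<lambda>k. case (u, k) of (u, k) \<Rightarrow> g u k)"
      by (auto simp: has_bochner_integral_iff)
    have "(\<lambda>u. LINT k|lborel. norm (case (u, k) of (u, k) \<Rightarrow> g u k)) = (\<lambda>u. 1 / C u)"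
      using g by (auto simp: has_bochner_integral_iff g_def abs_mult)
    moreover have "integrable lborel (\<lambda>u. 1 / C u)"
    proof (rule Bochner_Integration.integrable_bound)
      show "integrable lborel (\<lambda>u :: real. 1 / (A - \<bar>B\<bar>) * (1 / cosh u))"
        by (intro integrable_mult_right integrable_inverse_cosh)
      have "1 / C u \<le> 1 / ((A - \<bar>B\<bar>) * cosh u)" for u
        using AB C[of u] cosh_sinh_ge[of A B u] unfolding C_def by (intro divide_left_mono) auto
      then show "AE u in lborel. norm (1 / C u) \<le> norm (1 / (A - \<bar>B\<bar>) * (1 / cosh u))"
        using C AB by (simp add: abs_of_pos)
    qed measurable
    ultimately show "integrable lborel (\<lambda>u. LINT k|lborel. norm (case (u, k) of (u, k) \<Rightarrow> g u k))"
      by simp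
  qed
  then have int: "integrable (lborel \<Otimes>\<^sub>M lborel) (case_prod h)"
  proof (rule Bochner_Integration.integrable_bound)
    show "case_prod h \<in> borel_measurable (lborel \<Otimes>\<^sub>M lborel)"
      unfolding h_def by measurable
    show "AE x in lborel \<Otimes>\<^sub>M lborel. norm (case_prod h x) \<le> norm (case_prod g x)"
      by (intro AE_I2) (auto simp: g_def h_def abs_mult mult_left_le split: split_indicator)
  qed
  have inner_u: "(LINT u|lborel. h u k) = indicator {0<..} k * (cos (k * Z) * macdonald_integral (k * A) (k * B))" for k
  proof -
    have "(LINT u|lborel. h u k)
        = (LINT u|lborel. indicator {0<..} k * cos (k * Z) * exp (- (k * A * cosh u - k * B * sinh u)))"
      unfolding h_def C_def by (intro Bochner_Integration.integral_cong) (auto simp: algebra_simps)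
    then show ?thesis
      by (simp add: macdonald_integral_def mult.assoc)
  qed
  have inner_k: "(LINT k|lborel. h u k) = C u / ((C u)\<^sup>2 + Z\<^sup>2)" for u
    unfolding h_def by (intro has_bochner_integral_integral_eq has_bochner_integral_exp_cos C)
  have "integrable lborel (\<lambda>k. indicator {0<..} k * (cos (k * Z) * macdonald_integral (k * A) (k * B)))"
    using lborel_pair.integrable_snd[OF int] unfolding inner_u .
  moreover have "(LINT k|lborel. indicator {0<..} k * (cos (k * Z) * macdonald_integral (k * A) (k * B)))
      = (LINT u|lborel. C u / ((C u)\<^sup>2 + Z\<^sup>2))"
    using lborel_pair.Fubini_integral[OF int] unfolding inner_u inner_k .
  moreover have "(LINT u|lborel. C u / ((C u)\<^sup>2 + Z\<^sup>2)) = pi / sqrt (A\<^sup>2 - B\<^sup>2 + Z\<^sup>2)"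
  proof -
    define L where "L = sqrt (A\<^sup>2 - B\<^sup>2 + Z\<^sup>2)"
    have "B\<^sup>2 < A\<^sup>2"
      using AB power_strict_mono[of "\<bar>B\<bar>" A 2] by simp
    then have L: "L > 0" "L\<^sup>2 = A\<^sup>2 - B\<^sup>2 + Z\<^sup>2"
      by (simp_all add: L_def add_pos_nonneg)
    have "1 / ((A * sinh u - B * cosh u)\<^sup>2 + L\<^sup>2) * (A * cosh u - B * sinh u) = C u / ((C u)\<^sup>2 + Z\<^sup>2)" for u
    proof -
      have "(C u)\<^sup>2 - (A * sinh u - B * cosh u)\<^sup>2 = (A\<^sup>2 - B\<^sup>2) * ((cosh u)\<^sup>2 - (sinh u)\<^sup>2)"
        by (simp add: C_def power2_eq_square algebra_simps)
      also have "\<dots> = A\<^sup>2 - B\<^sup>2"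
        by (simp add: cosh_square_eq)
      finally have "(A * sinh u - B * cosh u)\<^sup>2 + L\<^sup>2 = (C u)\<^sup>2 + Z\<^sup>2"
        by (simp add: L)
      then show ?thesis
        by (simp add: C_def)
    qed
    moreover have "has_bochner_integral lborel
        (\<lambda>u. 1 / ((A * sinh u - B * cosh u)\<^sup>2 + L\<^sup>2) * (A * cosh u - B * sinh u)) (pi / L)"
      by (subst has_bochner_integral_hyperbolic_subst[OF AB])
         (auto intro: has_bochner_integral_lorentz[OF L(1)])
    ultimately show ?thesis
      by (simp add: has_bochner_integral_iff L_def)
  qed
  ultimately show ?thesis
    by (simp add: has_bochner_integral_iff)
qed

text \<open>Every term is real: \<open>(- \<i>) ^ n\<close> cancels the power of \<open>\<i>\<close>
  from the Hermite polynomial at an imaginary argument. The exponent \<open>n - 1\<close> of 2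
  leaves a factor 2, which the product formula turns into \<open>1 / sqrt pi\<close>.\<close>

lemma expansion_term_eq:
  assumes "0 \<le> a" "a \<le> b" "k \<ge> 0"
  shows "expansion_term \<xi> \<xi>\<^sub>0 a b k n = of_real (1 / sqrt pi
    * (mehler_coeff (sqrt k * \<xi>) (sqrt k * \<xi>\<^sub>0) n * tanh_moment n (sqrt k * a) (sqrt k * b)))"
proof -
  define x y a' b' where "x = sqrt k * \<xi>" and "y = sqrt k * \<xi>\<^sub>0" and "a' = sqrt k * a" and "b' = sqrt k * b"
  have two: "2 powi (int n - 1) = (2 ^ n / 2 :: complex)"
    by (simp add: power_int_diff)
  have "(- \<i>) ^ n * \<i> ^ n = 1"
    by (simp flip: power_mult_distrib)
  moreover have "expansion_term \<xi> \<xi>\<^sub>0 a b k n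
      = ((- \<i>) ^ n * \<i> ^ n) * (2 * (of_real (hermite_poly n x) * of_real (hermite_poly n y) / (2 ^ n * fact n))
        * (of_real (hermite_poly_imag n a') * of_real (hermite_neg n b')))"
    unfolding expansion_term_def x_def[symmetric] y_def[symmetric] a'_def[symmetric] b'_def[symmetric]
      two hermite_H_of_nat hermite_H_neg hermite_poly_imag_eq of_real_hermite_poly[symmetric]
    by (simp add: field_simps)
  ultimately have "expansion_term \<xi> \<xi>\<^sub>0 a b k n
      = 2 * (of_real (hermite_poly n x) * of_real (hermite_poly n y) / (2 ^ n * fact n))
        * (of_real (hermite_poly_imag n a') * of_real (hermite_neg n b'))"
    by simp
  also have "\<dots> = of_real (mehler_coeff x y n * (2 * (hermite_poly_imag n a' * hermite_neg n b')))"
    by (simp add: mehler_coeff_def)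
  also have "2 * (hermite_poly_imag n a' * hermite_neg n b') = 1 / sqrt pi * tanh_moment n a' b'"
  proof -
    have "0 \<le> a'" "a' \<le> b'"
      using assms by (simp_all add: a'_def b'_def mult_left_mono)
    from hermite_product[OF this, of n] show ?thesis
      by (simp add: field_simps)
  qed
  finally show ?thesis
    by (simp add: x_def y_def a'_def b'_def)
qed

text \<open>The exponential prefactor of the integrand is the reciprocal of the one produced by the
  summation, so only the cosine and the Macdonald integral survive.\<close>

lemma expansion_integrand_eq:
  assumes ab: "0 \<le> a" "a \<le> b" and k: "k > 0"
    and ne: "\<xi> \<noteq> \<xi>\<^sub>0 \<or> a \<noteq> b" "\<xi> \<noteq> - \<xi>\<^sub>0 \<or> a \<noteq> - b"
  shows "summable (expansion_term \<xi> \<xi>\<^sub>0 a b k)"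
    and "expansion_integrand \<xi> \<xi>\<^sub>0 a b z z\<^sub>0 k = of_real (1 / (2 * sqrt pi) * (cos (k * (z - z\<^sub>0))
      * macdonald_integral (k * ((\<xi>\<^sup>2 + \<xi>\<^sub>0\<^sup>2 + a\<^sup>2 + b\<^sup>2) / 2)) (k * (\<xi> * \<xi>\<^sub>0 + a * b))))"
proof -
  define M where "M = macdonald_integral (k * ((\<xi>\<^sup>2 + \<xi>\<^sub>0\<^sup>2 + a\<^sup>2 + b\<^sup>2) / 2)) (k * (\<xi> * \<xi>\<^sub>0 + a * b))"
  define e where "e = exp (k / 2 * (\<xi>\<^sup>2 + b\<^sup>2 + \<xi>\<^sub>0\<^sup>2 - a\<^sup>2))"
  have sq: "(sqrt k * v)\<^sup>2 = k * v\<^sup>2" for v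
    using k by (simp add: power_mult_distrib)
  have pr: "(sqrt k * v) * (sqrt k * w) = k * (v * w)" for v w
    using k by (simp add: mult_ac)
  have ex: "(k * \<xi>\<^sup>2 + k * \<xi>\<^sub>0\<^sup>2 + k * b\<^sup>2 - k * a\<^sup>2) / 2 = k / 2 * (\<xi>\<^sup>2 + b\<^sup>2 + \<xi>\<^sub>0\<^sup>2 - a\<^sup>2)"
    "(k * \<xi>\<^sup>2 + k * \<xi>\<^sub>0\<^sup>2 + k * a\<^sup>2 + k * b\<^sup>2) / 2 = k * ((\<xi>\<^sup>2 + \<xi>\<^sub>0\<^sup>2 + a\<^sup>2 + b\<^sup>2) / 2)"
    "k * (\<xi> * \<xi>\<^sub>0) + k * (a * b) = k * (\<xi> * \<xi>\<^sub>0 + a * b)"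
    by (simp_all add: field_simps)
  have "sqrt k * \<xi> \<noteq> sqrt k * \<xi>\<^sub>0 \<or> sqrt k * a \<noteq> sqrt k * b"
    using ne(1) k by simp
  moreover have "sqrt k * \<xi> \<noteq> - (sqrt k * \<xi>\<^sub>0) \<or> sqrt k * a \<noteq> - (sqrt k * b)"
  proof -
    have "sqrt k * v = - (sqrt k * w) \<longleftrightarrow> v = - w" for v w
      using mult_cancel_left[of "sqrt k" v "- w"] k by simp
    then show ?thesis
      using ne(2) by simp
  qed
  ultimately have "(\<lambda>n. mehler_coeff (sqrt k * \<xi>) (sqrt k * \<xi>\<^sub>0) n * tanh_moment n (sqrt k * a) (sqrt k * b))
      sums (e * (M / 2))"
    using mehler_tanh_moment_sums[of "sqrt k * \<xi>" "sqrt k * \<xi>\<^sub>0" "sqrt k * a" "sqrt k * b"]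
    unfolding sq pr ex e_def M_def by blast
  then have "(\<lambda>n. complex_of_real (1 / sqrt pi * (mehler_coeff (sqrt k * \<xi>) (sqrt k * \<xi>\<^sub>0) n
      * tanh_moment n (sqrt k * a) (sqrt k * b)))) sums of_real (1 / sqrt pi * (e * (M / 2)))"
    by (intro sums_of_real sums_mult)
  then have sums: "expansion_term \<xi> \<xi>\<^sub>0 a b k sums of_real (1 / sqrt pi * (e * (M / 2)))"
    unfolding expansion_term_eq[OF ab less_imp_le[OF k], abs_def] .
  then show "summable (expansion_term \<xi> \<xi>\<^sub>0 a b k)"
    by (rule sums_summable)
  have "exp (- (k / 2) * (\<xi>\<^sup>2 + b\<^sup>2 + \<xi>\<^sub>0\<^sup>2 - a\<^sup>2)) = 1 / e"
    by (simp add: e_def exp_minus inverse_eq_divide)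
  then have "expansion_integrand \<xi> \<xi>\<^sub>0 a b z z\<^sub>0 k
      = of_real (1 / e * cos (k * (z - z\<^sub>0)) * (1 / sqrt pi * (e * (M / 2))))"
    unfolding expansion_integrand_def sums_unique[OF sums, symmetric] by simp
  also have "1 / e * cos (k * (z - z\<^sub>0)) * (1 / sqrt pi * (e * (M / 2)))
      = 1 / (2 * sqrt pi) * (cos (k * (z - z\<^sub>0)) * M)"
    by (simp add: e_def)
  finally show "expansion_integrand \<xi> \<xi>\<^sub>0 a b z z\<^sub>0 k = of_real (1 / (2 * sqrt pi) * (cos (k * (z - z\<^sub>0))
      * macdonald_integral (k * ((\<xi>\<^sup>2 + \<xi>\<^sub>0\<^sup>2 + a\<^sup>2 + b\<^sup>2) / 2)) (k * (\<xi> * \<xi>\<^sub>0 + a * b))))"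
    by (simp add: M_def)
qed

text \<open>The hypothesis \<open>not_vertical\<close> amounts to \<open>\<bar>B\<bar> < A\<close>.
  For points on one vertical line \<open>A = \<bar>B\<bar>\<close>, and the integrand
  \<open>exp (- k * (A * cosh u - B * sinh u))\<close> tends to 1 at an end of the line, so the
  integral to which the series should sum diverges. Summability and integrability are part of the
  conclusion because \<open>suminf\<close> and the Lebesgue integral are total and would otherwise
  carry no convergence.\<close>

theorem theorem2p3:
  fixes p p\<^sub>0 :: "real ^ 3" and \<xi> \<eta> z \<xi>\<^sub>0 \<eta>\<^sub>0 z\<^sub>0 :: real
  assumes coords: "parabolic_cylinder_coords p \<xi> \<eta> z"
    and coords0: "parabolic_cylinder_coords p\<^sub>0 \<xi>\<^sub>0 \<eta>\<^sub>0 z\<^sub>0"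
    and distinct: "p \<noteq> p\<^sub>0"
    and not_vertical: "\<not> (p $ 1 = p\<^sub>0 $ 1 \<and> p $ 2 = p\<^sub>0 $ 2)"
  shows "(\<forall>k>0. summable (expansion_term \<xi> \<xi>\<^sub>0 (min \<eta> \<eta>\<^sub>0) (max \<eta> \<eta>\<^sub>0) k)) \<and>
    set_integrable lborel {0<..}
      (expansion_integrand \<xi> \<xi>\<^sub>0 (min \<eta> \<eta>\<^sub>0) (max \<eta> \<eta>\<^sub>0) z z\<^sub>0) \<and>
    complex_of_real (1 / norm (p - p\<^sub>0)) =
      of_real (2 / sqrt pi) *
        (LINT k:{0<..}|lborel.
          expansion_integrand \<xi> \<xi>\<^sub>0 (min \<eta> \<eta>\<^sub>0) (max \<eta> \<eta>\<^sub>0) z z\<^sub>0 k)"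
proof -
  define a b where "a = min \<eta> \<eta>\<^sub>0" and "b = max \<eta> \<eta>\<^sub>0"
  define A B where "A = (\<xi>\<^sup>2 + \<xi>\<^sub>0\<^sup>2 + a\<^sup>2 + b\<^sup>2) / 2" and "B = \<xi> * \<xi>\<^sub>0 + a * b"
  have p: "\<eta> \<ge> 0" "p $ 1 = (\<xi>\<^sup>2 - \<eta>\<^sup>2) / 2" "p $ 2 = \<xi> * \<eta>" "p $ 3 = z"
    and p0: "\<eta>\<^sub>0 \<ge> 0" "p\<^sub>0 $ 1 = (\<xi>\<^sub>0\<^sup>2 - \<eta>\<^sub>0\<^sup>2) / 2" "p\<^sub>0 $ 2 = \<xi>\<^sub>0 * \<eta>\<^sub>0" "p\<^sub>0 $ 3 = z\<^sub>0"
    using coords coords0 by (simp_all add: parabolic_cylinder_coords_def)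
  have ab: "0 \<le> a" "a \<le> b"
    using p(1) p0(1) by (simp_all add: a_def b_def)
  have ne: "\<xi> \<noteq> \<xi>\<^sub>0 \<or> a \<noteq> b" "\<xi> \<noteq> - \<xi>\<^sub>0 \<or> a \<noteq> - b"
  proof -
    show "\<xi> \<noteq> \<xi>\<^sub>0 \<or> a \<noteq> b"
    proof (rule ccontr)
      assume "\<not> (\<xi> \<noteq> \<xi>\<^sub>0 \<or> a \<noteq> b)"
      then have "\<xi> = \<xi>\<^sub>0" "\<eta> = \<eta>\<^sub>0"
        by (auto simp: a_def b_def min_def max_def split: if_splits)
      then show False
        using not_vertical p p0 by simp
    qed
    \<comment> \<open>With \<open>0 \<le> a \<le> b\<close>, \<open>a = - b\<close> forces both
      \<eta>-coordinates to be 0, where opposite values of \<xi> describe the same horizontal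
      position.\<close>
    show "\<xi> \<noteq> - \<xi>\<^sub>0 \<or> a \<noteq> - b"
    proof (rule ccontr)
      assume "\<not> (\<xi> \<noteq> - \<xi>\<^sub>0 \<or> a \<noteq> - b)"
      then have "\<xi> = - \<xi>\<^sub>0" "a = 0" "b = 0"
        using ab by auto
      then have "\<xi> = - \<xi>\<^sub>0" "\<eta> = 0" "\<eta>\<^sub>0 = 0"
        using p(1) p0(1) by (auto simp: a_def b_def min_def max_def split: if_splits)
      then show False
        using not_vertical p p0 by simp
    qed
  qed
  have AB: "\<bar>B\<bar> < A"
  proof -
    have "(\<xi> - \<xi>\<^sub>0)\<^sup>2 + (a - b)\<^sup>2 > 0" "(\<xi> + \<xi>\<^sub>0)\<^sup>2 + (a + b)\<^sup>2 > 0"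
      using ne by (auto simp: sum_power2_gt_zero_iff eq_neg_iff_add_eq_0)
    moreover have "2 * (A - B) = (\<xi> - \<xi>\<^sub>0)\<^sup>2 + (a - b)\<^sup>2" "2 * (A + B) = (\<xi> + \<xi>\<^sub>0)\<^sup>2 + (a + b)\<^sup>2"
      by (simp_all add: A_def B_def power2_eq_square algebra_simps)
    ultimately have "0 < 2 * (A - B)" "0 < 2 * (A + B)"
      by simp_all
    then show ?thesis
      by (simp add: abs_less_iff)
  qed
  have sym: "a\<^sup>2 + b\<^sup>2 = \<eta>\<^sup>2 + \<eta>\<^sub>0\<^sup>2" "a * b = \<eta> * \<eta>\<^sub>0"
    by (auto simp: a_def b_def min_def max_def)
  have "(norm (p - p\<^sub>0))\<^sup>2 = (p $ 1 - p\<^sub>0 $ 1)\<^sup>2 + (p $ 2 - p\<^sub>0 $ 2)\<^sup>2 + (p $ 3 - p\<^sub>0 $ 3)\<^sup>2"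
    by (simp add: norm_vec_def L2_set_def sum_3)
  \<comment> \<open>With \<open>\<zeta> = \<xi> + \<i> * \<eta>\<close> the horizontal position is
    \<open>\<zeta>\<^sup>2 / 2\<close>. The squared horizontal distance is thus a quarter of the
    product of the squared moduli of \<open>\<zeta> - \<zeta>\<^sub>0\<close> and
    \<open>\<zeta> + \<zeta>\<^sub>0\<close>, which are \<open>2 * (A - B)\<close> and
    \<open>2 * (A + B)\<close>.\<close>
  also have "\<dots> = A\<^sup>2 - B\<^sup>2 + (z - z\<^sub>0)\<^sup>2"
  proof -
    have AB_eq: "A = (\<xi>\<^sup>2 + \<xi>\<^sub>0\<^sup>2 + (\<eta>\<^sup>2 + \<eta>\<^sub>0\<^sup>2)) / 2" "B = \<xi> * \<xi>\<^sub>0 + \<eta> * \<eta>\<^sub>0"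
      using sym by (simp_all add: A_def B_def)
    show ?thesis
      unfolding p p0 AB_eq by (simp add: power2_eq_square field_simps)
  qed
  finally have norm: "norm (p - p\<^sub>0) = sqrt (A\<^sup>2 - B\<^sup>2 + (z - z\<^sub>0)\<^sup>2)"
    by (intro real_sqrt_unique[symmetric]) auto
  define f where "f = (\<lambda>k. 1 / (2 * sqrt pi)
    * (indicator {0<..} k * (cos (k * (z - z\<^sub>0)) * macdonald_integral (k * A) (k * B))))"
  have "has_bochner_integral lborel f (1 / (2 * sqrt pi) * (pi / norm (p - p\<^sub>0)))"
    unfolding f_def norm by (intro has_bochner_integral_mult_right has_bochner_integral_macdonald_cos AB)
  then have "has_bochner_integral lborel (\<lambda>k. complex_of_real (f k))
      (of_real (1 / (2 * sqrt pi) * (pi / norm (p - p\<^sub>0))))"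
    by (rule has_bochner_integral_of_real)
  also have "(\<lambda>k. complex_of_real (f k)) = (\<lambda>k. indicator {0<..} k *\<^sub>R expansion_integrand \<xi> \<xi>\<^sub>0 a b z z\<^sub>0 k)"
    using expansion_integrand_eq(2)[OF ab _ ne, of _ z z\<^sub>0]
    by (auto simp: fun_eq_iff f_def A_def B_def split: split_indicator)
  finally have int: "has_bochner_integral lborel
      (\<lambda>k. indicator {0<..} k *\<^sub>R expansion_integrand \<xi> \<xi>\<^sub>0 a b z z\<^sub>0 k)
      (of_real (1 / (2 * sqrt pi) * (pi / norm (p - p\<^sub>0))))" .
  have "2 / sqrt pi * (1 / (2 * sqrt pi) * (pi / norm (p - p\<^sub>0))) = 1 / norm (p - p\<^sub>0)"
  proof -
    have "2 / s * (1 / (2 * s) * (s * s / r)) = 1 / r" if "s > 0" for s r :: real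
      using that by simp
    from this[of "sqrt pi"] show ?thesis
      by simp
  qed
  then have "complex_of_real (1 / norm (p - p\<^sub>0))
      = of_real (2 / sqrt pi) * (LINT k:{0<..}|lborel. expansion_integrand \<xi> \<xi>\<^sub>0 a b z z\<^sub>0 k)"
    unfolding set_lebesgue_integral_def has_bochner_integral_integral_eq[OF int]
      of_real_mult[symmetric] by simp
  with int expansion_integrand_eq(1)[OF ab _ ne] show ?thesis
    unfolding set_integrable_def a_def[symmetric] b_def[symmetric]
    by (auto simp: has_bochner_integral_iff)
qed

end
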